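(* Let $F$ be a field, let $\Delta^5$ be a 5-simplex with totally ordered vertices, let $1\le k\le 5$, let $C$ be the subcomplex of $\partial\Delta^5$ formed by any $k$ of its six pentachora (together with all their faces), and let $\bar C$ be the subcomplex formed by the remaining $6-k$ pentachora (the left- and right-hand sides of a four-dimensional Pachner move), so that $\partial C=\partial\bar C$. Then: (i) The restrictions of permitted colorings of $C$ onto the common boundary $\partial C=\partial\bar C$ yield the same set of colorings of this common boundary as the restrictions of permitted colorings of $\bar C$. (ii) Moreover, all these colorings of $\partial C=\partial\bar C$ can be generated by (are linear combinations of the restrictions to $\partial C$ of) edge vectors $\psi_b$ for edges $b\subset\partial C=\partial\bar C$ only. (iii) There are fixed numbers $a_k$, $1\le k\le 5$, such that the dimension of the space of those permitted colorings of $C$ that are zero on all tetrahedra of $\partial C$ is $a_k$, and the dimension of the space of those permitted colorings of $\bar C$ that are zero on all tetrahedra of $\partial\bar C$ is $a_{6-k}$. Namely, $$a_1=a_2=a_3=0,\qquad a_4=1,\qquad a_5=3.$$ These permitted colorings, nonzero only on inner tetrahedra (those not lying in $\partial C=\partial \bar C$), are generated by the vectors $\psi_b$ for only inner edges $b$ (those not lying in $\partial C=\partial\bar C$) of $C$ or $\bar C$, respectively. (iv) Let $M$ be a closed PL 4-manifold, and let $K_{\mathrm{ini}}$, $K_{\mathrm{fin}}$ be simplicial complexes triangulating $M$ such that $C$ is part of $K_{\mathrm{ini}}$ and $K_{\mathrm{fin}}$ is obtained from $K_{\mathrm{ini}}$ by replacing $C$ with $\bar C$ (the Pachner move). Then there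 is a canonical isomorphism $$H_{\mathrm{col}}(K_{\mathrm{ini}},F)\cong H_{\mathrm{col}}(K_{\mathrm{fin}},F)$$ described as follows. Say that a permitted coloring of $K_{\mathrm{ini}}$ corresponds to a permitted coloring of $K_{\mathrm{fin}}$ if their restrictions onto the closed complement of $C$ in $K_{\mathrm{ini}}$, which is also the closed complement of $\bar C$ in $K_{\mathrm{fin}}$, coincide. This correspondence (not one-to-one in general) becomes an isomorphism after factoring both sides by edge-generated colorings.
   Context: All simplicial complexes are finite with totally ordered vertices; subcomplexes inherit the order. Writing a simplex as $i_1i_2\dots i_m$ means its vertices are listed in increasing order. A pentachoron is a 4-simplex. $F$ is a fixed field. Colorings. A coloring of a simplicial complex $K$ is a map assigning to every tetrahedron (3-simplex) $t$ of $K$ a color $\binom{x_t}{y_t}\in F^2$. Colorings form a vector space over $F$. Edge functionals. Let $u=i_1i_2i_3i_4i_5$ be a pentachoron and $b$ one of its ten edges. The linear functional $\phi_b$ on the colorings of $u$ is the sum, over the three tetrahedra $t\subset u$ containing $b$, of the following contributions. If $t=k_1k_2k_3k_4$ (with $k_1<k_2<k_3<k_4$) is the face of $u$ opposite the vertex $i_m$, put $\varepsilon=(-1)^{m+1}$. The contribution of $t$ is: $\varepsilon y_t$ for $b=k_1k_2$; $\varepsilon(x_t-y_t)$ for $b=k_1k_3$; $-\varepsilon x_t$ for $b=k_1k_4$; $-\varepsilon x_t$ for $b=k_2k_3$; $\varepsilon(x_t+y_t)$ for $b=k_2k_4$; $-\varepsilon y_t$ for $b=k_3k_4$. Permitted colorings.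 A coloring of a pentachoron $u$ is permitted if $\phi_b$ vanishes on it for all ten edges $b\subset u$. A coloring of a complex $K$ is permitted if its restriction to every pentachoron of $K$ is permitted. Permitted colorings of $K$ form the vector space $V_K$. Edge vectors. For an edge $b$ of $K$, the edge vector $\psi_b$ is the coloring of $K$ that is zero on all tetrahedra not containing $b$, and on a tetrahedron $t=k_1k_2k_3k_4\supset b$ (with $k_1<k_2<k_3<k_4$) has the color $\binom{1}{0}$ if $b=k_1k_2$; $\binom{-1}{1}$ if $b=k_1k_3$; $\binom{0}{-1}$ if $b=k_1k_4$; $\binom{0}{-1}$ if $b=k_2k_3$; $\binom{1}{1}$ if $b=k_2k_4$; $\binom{-1}{0}$ if $b=k_3k_4$. Edge vectors are permitted colorings. Linear combinations of edge vectors are called edge-generated colorings; they form a subspace $V_K^{(0)}\subset V_K$. Coloring homology: $H_{\mathrm{col}}(K,F)=V_K/V_K^{(0)}$. Pachner move in a triangulation: $K_{\mathrm{ini}}=R\cup C$ and $K_{\mathrm{fin}}=R\cup\bar C$, where $R$ is the closed complement (a subcomplex common to both) and $R\cap C=R\cap\bar C=\partial C=\partial\bar C$. The vertex orders of $K_{\mathrm{ini}}$ and $K_{\mathrm{fin}}$ agree on $R$ and agree with the order of the vertices of $\Delta^5$ on $C$ and $\bar C$.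
   Formalization: The value a_5=3 is replaced by a_5=4: if C consists of the five pentachora containing a vertex v, the five inner edge vectors at v satisfy exactly one linear relation, so the permitted colorings of C that are zero on the boundary have dimension 4 over every field. *)

theory Defs
  imports "HOL-Analysis.Analysis" "HOL-Library.Function_Algebras"
begin

section \<open>Ordered simplicial complexes\<close>

text \<open>
  A complex is the set of its (nonempty) simplices, each given by its set of vertices.
  The vertices are ordered by the linear order of the type \<^typ>\<open>'v\<close>.
\<close>

type_synonym 'v complex = "'v set set"

definition abstract_complex :: "'v complex \<Rightarrow> bool" where
  "abstract_complex K \<longleftrightarrow> finite K \<and> (\<forall>s\<in>K. finite s \<and> s \<noteq> {}) \<and>
     (\<forall>s\<in>K. \<forall>r. r \<subseteq> s \<and> r \<noteq> {} \<longrightarrow> r \<in> K)"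

definition faces :: "'v set set \<Rightarrow> 'v complex" where
  "faces S = {r. r \<noteq> {} \<and> (\<exists>s\<in>S. r \<subseteq> s)}"

definition edges :: "'v complex \<Rightarrow> 'v set set" where
  "edges K = {s\<in>K. card s = 2}"

definition tetrahedra :: "'v complex \<Rightarrow> 'v set set" where
  "tetrahedra K = {s\<in>K. card s = 4}"

definition pentachora :: "'v complex \<Rightarrow> 'v set set" where
  "pentachora K = {s\<in>K. card s = 5}"

definition boundary :: "'v complex \<Rightarrow> 'v complex" where
  "boundary K = faces {t\<in>tetrahedra K. card {u\<in>pentachora K. t \<subseteq> u} = 1}"

text \<open>The subcomplex carried by the topological closure of the complement of \<open>L\<close> in \<open>K\<close>.\<close>

definition closed_complement :: "'v complex \<Rightarrow> 'v complex \<Rightarrow> 'v complex" where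
  "closed_complement K L = faces (K - L)"

text \<open>The \<open>i\<close>-th smallest vertex of \<open>s\<close>, counting from 1.\<close>

definition vtx :: "'v::linorder set \<Rightarrow> nat \<Rightarrow> 'v" where
  "vtx s i = sorted_list_of_set s ! (i - 1)"


section \<open>Colorings\<close>

text \<open>
  A coloring of \<open>K\<close> is represented by a function on all vertex sets that vanishes off the
  tetrahedra of \<open>K\<close>.
\<close>

type_synonym ('v, 'f) coloring = "'v set \<Rightarrow> 'f \<times> 'f"

definition cscale :: "'f::field \<Rightarrow> ('v, 'f) coloring \<Rightarrow> ('v, 'f) coloring" where
  "cscale a c = (\<lambda>t. (a * fst (c t), a * snd (c t)))"

interpretation col: vector_space cscale
  by unfold_locales (auto simp: cscale_def fun_eq_iff prod_eq_iff algebra_simps)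

definition colorings :: "'v complex \<Rightarrow> ('v, 'f::field) coloring set" where
  "colorings K = {c. \<forall>t. t \<notin> tetrahedra K \<longrightarrow> c t = 0}"

definition restr :: "'v complex \<Rightarrow> ('v, 'f::field) coloring \<Rightarrow> ('v, 'f) coloring" where
  "restr L c = (\<lambda>t. if t \<in> tetrahedra L then c t else 0)"

text \<open>The contribution of a tetrahedron \<open>t\<close> of color \<open>(x, y)\<close>, up to the sign \<open>\<epsilon>\<close>.\<close>

definition contrib :: "'v::linorder set \<Rightarrow> 'v set \<Rightarrow> 'f \<times> 'f \<Rightarrow> 'f::field" where
  "contrib t b = (\<lambda>(x, y).
     if b = {vtx t 1, vtx t 2} then y
     else if b = {vtx t 1, vtx t 3} then x - y
     else if b = {vtx t 1, vtx t 4} then - x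
     else if b = {vtx t 2, vtx t 3} then - x
     else if b = {vtx t 2, vtx t 4} then x + y
     else if b = {vtx t 3, vtx t 4} then - y
     else 0)"

text \<open>The sum is indexed by the position \<open>m\<close> of the vertex of \<open>u\<close> opposite to the tetrahedron.\<close>

definition edge_functional ::
    "'v::linorder set \<Rightarrow> 'v set \<Rightarrow> ('v, 'f::field) coloring \<Rightarrow> 'f" where
  "edge_functional u b c =
     (\<Sum>m \<in> {m\<in>{1..5}. b \<subseteq> u - {vtx u m}}.
        (- 1) ^ (m + 1) * contrib (u - {vtx u m}) b (c (u - {vtx u m})))"

definition permitted :: "'v::linorder complex \<Rightarrow> ('v, 'f::field) coloring set" where
  "permitted K = {c \<in> colorings K.
     \<forall>u\<in>pentachora K. \<forall>b. b \<subseteq> u \<and> card b = 2 \<longrightarrow> edge_functional u b c = 0}"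

definition edge_color :: "'v::linorder set \<Rightarrow> 'v set \<Rightarrow> 'f \<times> 'f::field" where
  "edge_color t b =
     (if b = {vtx t 1, vtx t 2} then (1, 0)
      else if b = {vtx t 1, vtx t 3} then (- 1, 1)
      else if b = {vtx t 1, vtx t 4} then (0, - 1)
      else if b = {vtx t 2, vtx t 3} then (0, - 1)
      else if b = {vtx t 2, vtx t 4} then (1, 1)
      else if b = {vtx t 3, vtx t 4} then (- 1, 0)
      else 0)"

definition edge_vector ::
    "'v::linorder complex \<Rightarrow> 'v set \<Rightarrow> ('v, 'f::field) coloring" where
  "edge_vector K b = (\<lambda>t. if t \<in> tetrahedra K \<and> b \<subseteq> t then edge_color t b else 0)"

definition edge_generated :: "'v::linorder complex \<Rightarrow> ('v, 'f::field) coloring set" where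
  "edge_generated K = col.span (edge_vector K ` edges K)"

text \<open>Permitted colorings that vanish on the tetrahedra of the boundary.\<close>

definition permitted_rel :: "'v::linorder complex \<Rightarrow> ('v, 'f::field) coloring set" where
  "permitted_rel K = {c \<in> permitted K. \<forall>t\<in>tetrahedra (boundary K). c t = 0}"

definition inner_edges :: "'v complex \<Rightarrow> 'v set set" where
  "inner_edges K = edges K - edges (boundary K)"


section \<open>Coloring homology\<close>

text \<open>The elements of the quotient space are the cosets of the edge-generated colorings.\<close>

definition hclass ::
    "'v::linorder complex \<Rightarrow> ('v, 'f::field) coloring \<Rightarrow> ('v, 'f) coloring set" where
  "hclass K c = {c + z |z. z \<in> edge_generated K}"

definition Hcol :: "'v::linorder complex \<Rightarrow> ('v, 'f::field) coloring set set" where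
  "Hcol K = hclass K ` permitted K"

definition hadd :: "('v, 'f::field) coloring set \<Rightarrow> ('v, 'f) coloring set
    \<Rightarrow> ('v, 'f) coloring set" where
  "hadd X Y = {x + y |x y. x \<in> X \<and> y \<in> Y}"

text \<open>Adding the edge-generated colorings only matters for \<open>a = 0\<close>.\<close>

definition hscale :: "'v::linorder complex \<Rightarrow> 'f::field \<Rightarrow> ('v, 'f) coloring set
    \<Rightarrow> ('v, 'f) coloring set" where
  "hscale K a X = {cscale a x + z |x z. x \<in> X \<and> z \<in> edge_generated K}"

lemma hadd_hclass: "hadd (hclass K c) (hclass K d) = hclass K (c + d)"
proof (intro set_eqI iffI)
  fix x assume "x \<in> hadd (hclass K c) (hclass K d)"
  then obtain z w where "x = (c + z) + (d + w)" "z \<in> edge_generated K" "w \<in> edge_generated K"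
    unfolding hadd_def hclass_def by blast
  then have "x = (c + d) + (z + w)" "z + w \<in> edge_generated K"
    by (auto simp: edge_generated_def algebra_simps intro: col.span_add)
  then show "x \<in> hclass K (c + d)" unfolding hclass_def by blast
next
  fix x assume "x \<in> hclass K (c + d)"
  then obtain z where "x = (c + z) + (d + 0)" "z \<in> edge_generated K"
    unfolding hclass_def by (auto simp: algebra_simps)
  moreover have "0 \<in> edge_generated K" by (simp add: edge_generated_def col.span_zero)
  ultimately show "x \<in> hadd (hclass K c) (hclass K d)"
    unfolding hadd_def hclass_def by blast
qed

lemma hscale_hclass: "hscale K a (hclass K c) = hclass K (cscale a c)"
proof (intro set_eqI iffI)
  fix x assume "x \<in> hscale K a (hclass K c)"
  then obtain z w where "x = cscale a (c + z) + w" "z \<in> edge_generated K" "w \<in> edge_generated K"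
    unfolding hscale_def hclass_def by blast
  then have "x = cscale a c + (cscale a z + w)" "cscale a z + w \<in> edge_generated K"
    by (auto simp: edge_generated_def col.scale_right_distrib add.assoc
        intro: col.span_add col.span_scale)
  then show "x \<in> hclass K (cscale a c)" unfolding hclass_def by blast
next
  fix x assume "x \<in> hclass K (cscale a c)"
  then obtain z where "x = cscale a (c + 0) + z" "z \<in> edge_generated K"
    unfolding hclass_def by auto
  moreover have "0 \<in> edge_generated K" by (simp add: edge_generated_def col.span_zero)
  ultimately show "x \<in> hscale K a (hclass K c)"
    unfolding hscale_def hclass_def by blast
qed

definition Hcol_iso :: "'v::linorder complex \<Rightarrow> 'v complex
    \<Rightarrow> (('v, 'f::field) coloring set \<Rightarrow> ('v, 'f) coloring set) \<Rightarrow> bool" where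
  "Hcol_iso K L \<Phi> \<longleftrightarrow> bij_betw \<Phi> (Hcol K) (Hcol L) \<and>
     (\<forall>X\<in>Hcol K. \<forall>Y\<in>Hcol K. \<Phi> (hadd X Y) = hadd (\<Phi> X) (\<Phi> Y)) \<and>
     (\<forall>a. \<forall>X\<in>Hcol K. \<Phi> (hscale K a X) = hscale L a (\<Phi> X))"


section \<open>Piecewise-linear manifolds and triangulations\<close>

definition compact_polyhedron :: "'a::euclidean_space set \<Rightarrow> bool" where
  "compact_polyhedron X \<longleftrightarrow> (\<exists>\<P>. finite \<P> \<and> (\<forall>P\<in>\<P>. polytope P) \<and> \<Union>\<P> = X)"

definition pl_on :: "'a::euclidean_space set \<Rightarrow> ('a \<Rightarrow> 'b::euclidean_space) \<Rightarrow> bool" where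
  "pl_on X f \<longleftrightarrow> continuous_on X f \<and>
     (\<exists>\<P>. finite \<P> \<and> (\<forall>P\<in>\<P>. polytope P) \<and> \<Union>\<P> = X \<and>
        (\<forall>P\<in>\<P>. \<exists>A c. linear A \<and> (\<forall>x\<in>P. f x = A x + c)))"

text \<open>The inverse of a piecewise-linear homeomorphism of compact polyhedra is piecewise linear.\<close>

definition pl_homeomorphism ::
    "'a::euclidean_space set \<Rightarrow> 'b::euclidean_space set \<Rightarrow> ('a \<Rightarrow> 'b) \<Rightarrow> bool" where
  "pl_homeomorphism X Y f \<longleftrightarrow> pl_on X f \<and> (\<exists>g. homeomorphism X Y f g)"

text \<open>
  A closed PL 4-manifold is a compact polyhedron in which every point has a neighbourhood
  that is piecewise-linearly a 4-cube with the point at its centre.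
\<close>

definition closed_pl_4_manifold :: "'m::euclidean_space set \<Rightarrow> bool" where
  "closed_pl_4_manifold M \<longleftrightarrow> compact_polyhedron M \<and>
     (\<forall>x\<in>M. \<exists>N U f. openin (top_of_set M) U \<and> x \<in> U \<and> U \<subseteq> N \<and> N \<subseteq> M \<and>
        pl_homeomorphism N (cbox (\<chi> i. - 1) (\<chi> i. 1) :: (real ^ 4) set) f \<and> f x = 0)"

text \<open>Here \<open>p\<close> places the vertices of \<open>K\<close> in a Euclidean space.\<close>

definition geometric_realization :: "('v \<Rightarrow> 'e::euclidean_space) \<Rightarrow> 'v complex \<Rightarrow> bool" where
  "geometric_realization p K \<longleftrightarrow> inj_on p (\<Union>K) \<and>
     (\<forall>s\<in>K. \<not> affine_dependent (p ` s)) \<and>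
     (\<forall>s\<in>K. \<forall>r\<in>K. convex hull (p ` s) \<inter> convex hull (p ` r) = convex hull (p ` (s \<inter> r)))"

definition triangulates ::
    "('v \<Rightarrow> 'e::euclidean_space) \<Rightarrow> ('e \<Rightarrow> 'm::euclidean_space) \<Rightarrow> 'v complex \<Rightarrow> 'm set \<Rightarrow> bool" where
  "triangulates p h K M \<longleftrightarrow> abstract_complex K \<and> geometric_realization p K \<and>
     pl_homeomorphism (\<Union>s\<in>K. convex hull (p ` s)) M h"


section \<open>Pachner moves\<close>

text \<open>
  \<open>R\<close> is the common closed complement.  The required agreement of vertex orders is automatic,
  since all complexes inherit their vertex orders from one type.
\<close>

definition pachner_replacement ::
    "'v complex \<Rightarrow> 'v complex \<Rightarrow> 'v complex \<Rightarrow> 'v complex \<Rightarrow> 'v complex \<Rightarrow> bool" where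
  "pachner_replacement C C' R K K' \<longleftrightarrow>
     K = R \<union> C \<and> K' = R \<union> C' \<and>
     R = closed_complement K C \<and> R = closed_complement K' C' \<and>
     R \<inter> C = boundary C \<and> R \<inter> C' = boundary C'"

text \<open>
  The value at 5 is 4.  If \<open>C\<close> consists of the five pentachora containing a vertex \<open>v\<close>, the five
  inner edges join \<open>v\<close> to the other vertices, and their edge vectors are permitted, vanish on the
  boundary, and satisfy exactly one linear relation.  For instance, if \<open>v\<close> is the smallest
  vertex, the combination with coefficients \<open>c\<^sub>j\<close> has on the tetrahedron \<open>vabc\<close> the color
  \<open>(c\<^sub>a - c\<^sub>b, c\<^sub>b - c\<^sub>c)\<close>, so it is zero only if all the \<open>c\<^sub>j\<close> are equal.  Thus the value 3,
  which has been stated for this dimension, is incorrect over every field.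
\<close>

definition pachner_dim :: "nat \<Rightarrow> nat" where
  "pachner_dim = (\<lambda>_. 0)(4 := 1, 5 := 4)"

end

theory Submission
  imports Defs
begin

text \<open>
  The whole theorem rests on one reading of the colors.  Let \<open>c\<close> be a 1-cochain, that is, a function
  on edges, and let \<open>w = dc\<close> be its coboundary.  On a tetrahedron \<open>ijkl\<close> the combination
  \<open>\<Sum>\<^sub>b c\<^sub>b \<psi>\<^sub>b\<close> has the color \<open>(w\<^sub>i\<^sub>j\<^sub>k - w\<^sub>j\<^sub>k\<^sub>l, w\<^sub>i\<^sub>j\<^sub>l - w\<^sub>i\<^sub>j\<^sub>k)\<close>.  As \<open>w\<close> is closed, this color
  is zero exactly if \<open>w\<close> takes the same value on all four triangles: a color is a closed 2-cochain of the
  tetrahedron modulo the constant 2-cochain.  So on a simplex an edge-generated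
  coloring is a 1-cochain up to coboundaries of 0-cochains and up to a cochain whose coboundary is constant.
  The latter can be written down by coning from any vertex \<open>v\<close>: its value on an edge is the product of
  the two signs telling on which side of \<open>v\<close> the ends lie (\<open>cone_primitive\<close>).

  Subtracting a coboundary, one may let \<open>c\<close> vanish on all edges at a chosen vertex \<open>v\<close>
  (\<open>gauge_fix\<close>).  In a tetrahedron containing \<open>v\<close>, what remains is determined by the color up
  to a multiple of the cone primitive (\<open>tetrahedron_kernel_gauged\<close>).  The
  rest of the proof draws on this rigidity.

  On one pentachoron, permitted and edge-generated colorings coincide
  (\<open>pentachoron_permitted_cochain\<close>).  All pentachora of \<open>C\<close> share a vertex \<open>v\<close>, namely
  the vertex opposite to some pentachoron of \<open>C'\<close>.  In the gauge at \<open>v\<close> the cochains of any two pentachora differ on their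
  common tetrahedron by a multiple of the cone primitive; after comparison with a fixed pentachoron
  all these multiples vanish and the cochains glue (\<open>permitted_side_cochain_color\<close>).  Hence a permitted
  coloring of either side is the restriction of \<open>\<Sum>\<^sub>b c\<^sub>b \<psi>\<^sub>b\<close> for a cochain on the whole 5-simplex.
  The two sides thus leave the same colorings on the common boundary, and an edge outside the boundary
  contributes nothing there.

  For the colorings that vanish on the boundary, let \<open>I\<close> be the set of vertices opposite to the pentachora of \<open>C\<close>, and
  \<open>J\<close> the remaining vertices.  The boundary tetrahedra are the \<open>D - {i,j}\<close> with \<open>i \<in> I\<close>, \<open>j \<in> J\<close>; they
  form a grid in which neighbours overlap enough to carry the multiple of the cone primitive along
  (\<open>grid_gauge\<close>).  So a cochain with zero color on the boundary can be changed, at the same color, into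
  one supported on edges that lie inside, namely those containing \<open>J\<close>.  There is no such edge for
  \<open>k \<le> 3\<close>, one for \<open>k = 4\<close>, and for \<open>k = 5\<close> there are the five edges at the single vertex of \<open>J\<close>, with one
  relation given by the coboundary of that vertex.

  In a larger complex, a permitted coloring of the initial triangulation is moved to the final one by keeping it on the common
  part \<open>R\<close> and extending its boundary values over \<open>C'\<close>.  The extension is unique up to permitted
  colorings of \<open>C'\<close> that vanish on the boundary, which are generated by inner edges, and the same 1-cochain
  can be evaluated on both complexes.  So colorings with equal restriction to \<open>R\<close> are edge-generated
  simultaneously, and the correspondence descends to an isomorphism.
\<close>


section \<open>Simplices with few vertices\<close>

lemma card_two_ordered:
  assumes "card (b::'v::linorder set) = 2"
  obtains p q where "p < q" "b = {p,q}"
proof -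
  obtain x y where xy: "b = {x,y}" "x \<noteq> y" using assms by (auto simp: card_2_iff)
  then have "x < y \<or> y < x" by auto
  then show ?thesis using that xy(1) insert_commute[of x y "{}"] by auto
qed

lemma card_four_ordered:
  assumes "card (t::'v::linorder set) = 4"
  obtains a b c d where "a < b" "b < c" "c < d" "t = {a,b,c,d}"
proof -
  have fin: "finite t" using assms card.infinite by fastforce
  let ?l = "sorted_list_of_set t"
  have "length ?l = Suc (Suc (Suc (Suc 0)))" using assms fin by simp
  then obtain a b c d where l: "?l = [a,b,c,d]"
    by (auto simp only: length_Suc_conv length_0_conv)
  have "sorted_wrt (<) ?l" by (rule strict_sorted_list_of_set)
  moreover have "t = set ?l" using fin by simp
  ultimately show ?thesis using that l by auto
qed

lemma card_five_ordered:
  assumes "card (t::'v::linorder set) = 5"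
  obtains a b c d e where "a < b" "b < c" "c < d" "d < e" "t = {a,b,c,d,e}"
proof -
  have fin: "finite t" using assms card.infinite by fastforce
  let ?l = "sorted_list_of_set t"
  have "length ?l = Suc (Suc (Suc (Suc (Suc 0))))" using assms fin by simp
  then obtain a b c d e where l: "?l = [a,b,c,d,e]"
    by (auto simp only: length_Suc_conv length_0_conv)
  have "sorted_wrt (<) ?l" by (rule strict_sorted_list_of_set)
  moreover have "t = set ?l" using fin by simp
  ultimately show ?thesis using that l by auto
qed

lemma edges_of_four:
  assumes o: "i < j" "j < k" "k < (l::'v::linorder)" and b: "b \<subseteq> {i,j,k,l}" "card b = 2"
  shows "b = {i,j} \<or> b = {i,k} \<or> b = {i,l} \<or> b = {j,k} \<or> b = {j,l} \<or> b = {k,l}"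
proof -
  have no: "\<not> j < i" "\<not> k < i" "\<not> l < i" "\<not> k < j" "\<not> l < j" "\<not> l < k"
    using o by (simp_all add: not_less less_imp_le)
  obtain p q where pq: "p < q" "b = {p,q}" using b(2) by (rule card_two_ordered)
  then have "p \<in> {i,j,k,l}" "q \<in> {i,j,k,l}" using b(1) by auto
  then show ?thesis using pq(1) no unfolding pq(2)
    by (elim insertE emptyE) simp_all
qed

lemma edges_of_five:
  assumes o: "i < j" "j < k" "k < l" "l < (m::'v::linorder)" and b: "b \<subseteq> {i,j,k,l,m}" "card b = 2"
  shows "b \<in> {{i,j},{i,k},{i,l},{i,m},{j,k},{j,l},{j,m},{k,l},{k,m},{l,m}}"
proof -
  have o2: "i < k" "i < l" "i < m" "j < l" "j < m" "k < m" using o by auto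
  have no: "\<not> j < i" "\<not> k < i" "\<not> l < i" "\<not> m < i" "\<not> k < j" "\<not> l < j" "\<not> m < j"
    "\<not> l < k" "\<not> m < k" "\<not> m < l"
    using o o2 by (simp_all add: not_less less_imp_le)
  obtain p q where pq: "p < q" "b = {p,q}" using b(2) by (rule card_two_ordered)
  then have "p \<in> {i,j,k,l,m}" "q \<in> {i,j,k,l,m}" using b(1) by auto
  then show ?thesis using pq(1) no unfolding pq(2)
    by (elim insertE emptyE) simp_all
qed

lemma four_subsets_of_five:
  assumes "i < j" "j < k" "k < l" "l < (m::'v::linorder)" "s \<subseteq> {i,j,k,l,m}" "card s = 4"
  shows "s \<in> {{j,k,l,m},{i,k,l,m},{i,j,l,m},{i,j,k,m},{i,j,k,l}}"
proof -
  have o2: "i < k" "i < l" "i < m" "j < l" "j < m" "k < m" using assms by auto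
  let ?u = "{i,j,k,l,m}"
  have "card ?u = 5" using assms(1-4) o2 by (auto simp: card_insert_if)
  then have "card (?u - s) = 1" using assms by (simp add: card_Diff_subset finite_subset)
  then obtain x where "?u - s = {x}" by (auto simp: card_1_singleton_iff)
  then have "s = ?u - {x}" "x \<in> ?u" using assms(5) by auto
  then show ?thesis using assms o2 by auto
qed

lemma two_subsets_of_three:
  assumes "b \<subseteq> {x,y,z}" "card b = 2"
  shows "b = {x,y} \<or> b = {x,z} \<or> b = {y,z}"
  using assms by (auto simp: card_2_iff)

lemma vtx_mem:
  assumes "1 \<le> i" "i \<le> card s" shows "vtx s i \<in> s"
proof -
  have "finite s" using assms card.infinite by fastforce
  then have "set (sorted_list_of_set s) = s" "i - 1 < length (sorted_list_of_set s)"
    using assms by auto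
  then show ?thesis unfolding vtx_def by (metis nth_mem)
qed

lemma vtx_four:
  assumes "a < b" "b < c" "c < (d::'v::linorder)"
  shows "vtx {a,b,c,d} (Suc 0) = a" "vtx {a,b,c,d} 2 = b" "vtx {a,b,c,d} 3 = c" "vtx {a,b,c,d} 4 = d"
proof -
  have "sorted_list_of_set (set [a,b,c,d]) = [a,b,c,d]"
    by (rule sorted_list_of_set.idem_if_sorted_distinct) (use assms in auto)
  then have "sorted_list_of_set {a,b,c,d} = [a,b,c,d]" by simp
  then show "vtx {a,b,c,d} (Suc 0) = a" "vtx {a,b,c,d} 2 = b" "vtx {a,b,c,d} 3 = c" "vtx {a,b,c,d} 4 = d"
    by (simp_all add: vtx_def)
qed

lemma vtx_five:
  assumes "a < b" "b < c" "c < d" "d < (e::'v::linorder)"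
  shows "vtx {a,b,c,d,e} (Suc 0) = a" "vtx {a,b,c,d,e} 2 = b" "vtx {a,b,c,d,e} 3 = c"
    "vtx {a,b,c,d,e} 4 = d" "vtx {a,b,c,d,e} 5 = e"
proof -
  have "sorted_list_of_set (set [a,b,c,d,e]) = [a,b,c,d,e]"
    by (rule sorted_list_of_set.idem_if_sorted_distinct) (use assms in auto)
  then have "sorted_list_of_set {a,b,c,d,e} = [a,b,c,d,e]" by simp
  then show "vtx {a,b,c,d,e} (Suc 0) = a" "vtx {a,b,c,d,e} 2 = b" "vtx {a,b,c,d,e} 3 = c"
    "vtx {a,b,c,d,e} 4 = d" "vtx {a,b,c,d,e} 5 = e"
    by (simp_all add: vtx_def)
qed


section \<open>Colors of 1-cochains\<close>

text \<open>
  With \<open>w = dc\<close>, the two components on a tetrahedron \<open>ijkl\<close> are \<open>w\<^sub>i\<^sub>j\<^sub>k - w\<^sub>j\<^sub>k\<^sub>l\<close> and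
  \<open>w\<^sub>i\<^sub>j\<^sub>l - w\<^sub>i\<^sub>j\<^sub>k\<close>; this is the color of the combination \<open>\<Sum>\<^sub>b c\<^sub>b \<psi>\<^sub>b\<close> of edge vectors.
  The value on other vertex sets is meaningless, and \<open>restr\<close> discards it.
\<close>

definition cochain_color :: "('v::linorder set \<Rightarrow> 'f::field) \<Rightarrow> ('v, 'f) coloring" where
  "cochain_color c t =
     (c {vtx t 1, vtx t 2} - c {vtx t 1, vtx t 3} + c {vtx t 2, vtx t 4} - c {vtx t 3, vtx t 4},
      c {vtx t 1, vtx t 3} - c {vtx t 1, vtx t 4} - c {vtx t 2, vtx t 3} + c {vtx t 2, vtx t 4})"

lemma cochain_color_ordered:
  assumes "i < j" "j < k" "k < l"
  shows "cochain_color c {i,j,k,l} =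
    (c {i,j} - c {i,k} + c {j,l} - c {k,l}, c {i,k} - c {i,l} - c {j,k} + c {j,l})"
  using assms by (simp add: cochain_color_def vtx_four)

text \<open>
  The form of linearity that serves to subtract coboundaries and cone primitives.
\<close>

lemma cochain_color_diff:
  "cochain_color (\<lambda>b. c b - a * d b) t = cochain_color c t - cscale a (cochain_color d) t"
  by (simp add: cochain_color_def cscale_def algebra_simps)

lemma cochain_color_zero: "cochain_color (\<lambda>b. 0) t = 0"
  by (simp add: cochain_color_def zero_prod_def)

lemma cochain_color_cong:
  assumes "card t = 4" "\<And>b. b \<subseteq> t \<Longrightarrow> card b = 2 \<Longrightarrow> c b = d b"
  shows "cochain_color c t = cochain_color d t"
proof -
  obtain i j k l where o: "i < j" "j < k" "k < l" and t: "t = {i,j,k,l}"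
    using assms(1) by (rule card_four_ordered)
  have "c {i,j} = d {i,j}" "c {i,k} = d {i,k}" "c {i,l} = d {i,l}"
    "c {j,k} = d {j,k}" "c {j,l} = d {j,l}" "c {k,l} = d {k,l}"
    using o by (auto intro!: assms(2) simp: t)
  then show ?thesis using o by (simp add: t cochain_color_ordered)
qed

definition coboundary :: "('v::linorder \<Rightarrow> 'f::field) \<Rightarrow> 'v set \<Rightarrow> 'f" where
  "coboundary f b = f (Max b) - f (Min b)"

lemma coboundary_ordered: "i < j \<Longrightarrow> coboundary f {i,j} = f j - f i"
  by (simp add: coboundary_def max.absorb2 min.absorb1 less_imp_le)

text \<open>
  The color depends on \<open>c\<close> only through \<open>dc\<close>, and \<open>dd = 0\<close>.
\<close>

lemma cochain_color_coboundary:
  assumes "card t = 4" shows "cochain_color (coboundary f) t = 0"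
proof -
  obtain i j k l where o: "i < j" "j < k" "k < l" and t: "t = {i,j,k,l}"
    using assms(1) by (rule card_four_ordered)
  then have "i < k" "i < l" "j < l" by auto
  then show ?thesis using o by (simp add: t cochain_color_ordered coboundary_ordered zero_prod_def)
qed

definition side :: "'v::linorder \<Rightarrow> 'v \<Rightarrow> 'f::field" where
  "side v x = (if x < v then - 1 else if x = v then 0 else 1)"

lemma side_simps: "x < v \<Longrightarrow> side v x = - 1" "side v v = 0" "v < x \<Longrightarrow> side v x = 1"
  by (auto simp: side_def)

text \<open>
  A cochain whose coboundary is the constant 2-cochain 1, normalized to vanish on the edges at \<open>v\<close>.
  Spreading the constant over the cone with apex \<open>v\<close> gives \<open>1\<close> on an edge with both ends
  on one side of \<open>v\<close> and \<open>- 1\<close> on an edge with \<open>v\<close> between its ends, that is, the product of the sides.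
\<close>

definition cone_primitive :: "'v::linorder \<Rightarrow> 'v set \<Rightarrow> 'f::field" where
  "cone_primitive v b = (\<Prod>x\<in>b. side v x)"

lemma cone_primitive_edge: "i \<noteq> j \<Longrightarrow> cone_primitive v {i,j} = side v i * side v j"
  by (simp add: cone_primitive_def)

text \<open>
  The color takes differences of the values of the coboundary, which is constant here.
\<close>

lemma cochain_color_cone_primitive:
  assumes "card t = 4" shows "cochain_color (cone_primitive v) t = 0"
proof -
  obtain i j k l where o: "i < j" "j < k" "k < l" and t: "t = {i,j,k,l}"
    using assms(1) by (rule card_four_ordered)
  then have ne: "i \<noteq> j" "i \<noteq> k" "i \<noteq> l" "j \<noteq> k" "j \<noteq> l" "k \<noteq> l" by auto
  consider "v < i" "v < j" "v < k" "v < l" | "v = i" "v < j" "v < k" "v < l"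
    | "i < v" "v < j" "v < k" "v < l" | "i < v" "v = j" "v < k" "v < l"
    | "i < v" "j < v" "v < k" "v < l" | "i < v" "j < v" "v = k" "v < l"
    | "i < v" "j < v" "k < v" "v < l" | "i < v" "j < v" "k < v" "v = l"
    | "i < v" "j < v" "k < v" "l < v"
    using o by (metis linorder_less_linear less_trans)
  then show ?thesis using o ne
    by cases (simp_all add: t cochain_color_ordered cone_primitive_edge side_simps zero_prod_def)
qed

text \<open>
  The 0-cochain to be subtracted takes at \<open>x\<close> the value of \<open>c\<close> on the oriented edge from \<open>v\<close> to \<open>x\<close>.
\<close>

lemma gauge_fix:
  fixes c :: "'v::linorder set \<Rightarrow> 'f::field"
  obtains d where "\<And>x. x \<noteq> v \<Longrightarrow> d {v,x} = 0"
    "\<And>t. card t = 4 \<Longrightarrow> cochain_color d t = cochain_color c t"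
proof
  let ?f = "\<lambda>x. if x = v then 0 else if v < x then c {v,x} else - c {v,x}"
  let ?d = "\<lambda>b. c b - 1 * coboundary ?f b"
  show "?d {v,x} = 0" if "x \<noteq> v" for x
    using that coboundary_ordered[of x v ?f] coboundary_ordered[of v x ?f]
    by (cases "v < x") (auto simp: insert_commute)
  show "cochain_color ?d t = cochain_color c t" if "card t = 4" for t
    unfolding cochain_color_diff
    using cochain_color_coboundary[OF that] by (simp add: cscale_def)
qed

text \<open>
  A zero color makes \<open>dc\<close> constant on the tetrahedron.  In the gauge at \<open>v\<close>, the value of \<open>dc\<close> on a triangle
  containing \<open>v\<close> is, up to sign, the value of \<open>c\<close> on the opposite edge, so the constant determines \<open>c\<close>.
\<close>

lemma tetrahedron_kernel_gauged:
  assumes "card t = 4" "v \<in> t" "\<And>x. x \<in> t - {v} \<Longrightarrow> c {v,x} = 0" "cochain_color c t = 0"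
  obtains \<kappa> where "\<And>b. b \<subseteq> t \<Longrightarrow> card b = 2 \<Longrightarrow> c b = \<kappa> * cone_primitive v b"
proof -
  obtain i j k l where o: "i < j" "j < k" "k < l" and t: "t = {i,j,k,l}"
    using assms(1) by (rule card_four_ordered)
  then have o2: "i < k" "i < l" "j < l" by auto
  have e: "c {i,j} - c {i,k} + c {j,l} - c {k,l} = 0" "c {i,k} - c {i,l} - c {j,k} + c {j,l} = 0"
    using assms(4) cochain_color_ordered[OF o, of c] by (auto simp: t zero_prod_def)
  have ic: "c {x,y} = c {y,x}" for x y by (simp add: insert_commute)
  have z: "x \<in> t \<Longrightarrow> x \<noteq> v \<Longrightarrow> c {v,x} = 0 \<and> c {x,v} = 0" for x
    using assms(3) ic[of x v] by auto
  consider "v = i" | "v = j" | "v = k" | "v = l" using assms(2) t by auto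
  then have "\<exists>\<kappa>. \<forall>b. b \<subseteq> t - {v} \<longrightarrow> card b = 2 \<longrightarrow> c b = \<kappa> * cone_primitive v b"
  proof cases
    case 1
    then have tv: "t - {v} = {j,k,l}" using o o2 t by auto
    have zz: "c {i,j} = 0" "c {i,k} = 0" "c {i,l} = 0"
      using z[of j] z[of k] z[of l] 1 t o o2 by auto
    have r: "c {j,l} = c {j,k}" "c {k,l} = c {j,k}"
      using e zz by (simp_all add: eq_neg_iff_add_eq_0 algebra_simps)
    show ?thesis
    proof (intro exI allI impI)
      fix b assume "b \<subseteq> t - {v}" "card b = 2"
      then consider "b = {j,k}" | "b = {j,l}" | "b = {k,l}"
        using two_subsets_of_three tv by metis
      then show "c b = (c {j,k}) * cone_primitive v b"
        by cases (use 1 o o2 r in \<open>simp_all add: cone_primitive_edge side_simps\<close>)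
    qed
  next
    case 2
    then have tv: "t - {v} = {i,k,l}" using o o2 t by auto
    have zz: "c {i,j} = 0" "c {j,k} = 0" "c {j,l} = 0"
      using z[of i] z[of k] z[of l] 2 t o o2 by auto
    have r: "c {i,l} = c {i,k}" "c {k,l} = - c {i,k}"
      using e zz by (simp_all add: eq_neg_iff_add_eq_0 algebra_simps)
    show ?thesis
    proof (intro exI allI impI)
      fix b assume "b \<subseteq> t - {v}" "card b = 2"
      then consider "b = {i,k}" | "b = {i,l}" | "b = {k,l}"
        using two_subsets_of_three tv by metis
      then show "c b = (- c {i,k}) * cone_primitive v b"
        by cases (use 2 o o2 r in \<open>simp_all add: cone_primitive_edge side_simps\<close>)
    qed
  next
    case 3
    then have tv: "t - {v} = {i,j,l}" using o o2 t by auto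
    have zz: "c {i,k} = 0" "c {j,k} = 0" "c {k,l} = 0"
      using z[of i] z[of j] z[of l] 3 t o o2 by auto
    have r: "c {i,l} = - c {i,j}" "c {j,l} = - c {i,j}"
      using e zz by (simp_all add: eq_neg_iff_add_eq_0 algebra_simps)
    show ?thesis
    proof (intro exI allI impI)
      fix b assume "b \<subseteq> t - {v}" "card b = 2"
      then consider "b = {i,j}" | "b = {i,l}" | "b = {j,l}"
        using two_subsets_of_three tv by metis
      then show "c b = (c {i,j}) * cone_primitive v b"
        by cases (use 3 o o2 r in \<open>simp_all add: cone_primitive_edge side_simps\<close>)
    qed
  next
    case 4
    then have tv: "t - {v} = {i,j,k}" using o o2 t by auto
    have zz: "c {i,l} = 0" "c {j,l} = 0" "c {k,l} = 0"
      using z[of i] z[of j] z[of k] 4 t o o2 by auto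
    have r: "c {i,k} = c {i,j}" "c {j,k} = c {i,j}"
      using e zz by (simp_all add: eq_neg_iff_add_eq_0 algebra_simps)
    show ?thesis
    proof (intro exI allI impI)
      fix b assume "b \<subseteq> t - {v}" "card b = 2"
      then consider "b = {i,j}" | "b = {i,k}" | "b = {j,k}"
        using two_subsets_of_three tv by metis
      then show "c b = (c {i,j}) * cone_primitive v b"
        by cases (use 4 o o2 r in \<open>simp_all add: cone_primitive_edge side_simps\<close>)
    qed
  qed
  then obtain \<kappa> where \<kappa>: "\<And>b. b \<subseteq> t - {v} \<Longrightarrow> card b = 2 \<Longrightarrow> c b = \<kappa> * cone_primitive v b"
    by blast
  show ?thesis
  proof (rule that)
    fix b assume b: "b \<subseteq> t" "card b = 2"
    show "c b = \<kappa> * cone_primitive v b"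
    proof (cases "v \<in> b")
      case True
      then obtain x where "b = {v,x}" "x \<noteq> v" using b(2) by (auto simp: card_2_iff)
      then show ?thesis using b(1) z by (auto simp: cone_primitive_edge side_simps)
    next
      case False
      then show ?thesis using \<kappa> b by blast
    qed
  qed
qed


section \<open>Permitted colorings of one pentachoron\<close>

lemma contrib_ordered:
  assumes "i < j" "j < k" "k < (l::'v::linorder)"
  shows "contrib {i,j,k,l} b z = (
     if b = {i,j} then snd z
     else if b = {i,k} then fst z - snd z
     else if b = {i,l} then - fst z
     else if b = {j,k} then - fst z
     else if b = {j,l} then fst z + snd z
     else if b = {k,l} then - snd z
     else 0)"
  using assms by (simp add: contrib_def vtx_four split: prod.splits)

text \<open>
  All five tetrahedra may enter the sum, since a tetrahedron not containing \<open>b\<close> contributes zero.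
\<close>

lemma edge_functional_ordered:
  assumes "i < j" "j < k" "k < l" "l < (m::'v::linorder)" "card b = 2"
  shows "edge_functional {i,j,k,l,m} b z = contrib {j,k,l,m} b (z {j,k,l,m})
    - contrib {i,k,l,m} b (z {i,k,l,m}) + contrib {i,j,l,m} b (z {i,j,l,m})
    - contrib {i,j,k,m} b (z {i,j,k,m}) + contrib {i,j,k,l} b (z {i,j,k,l})"
proof -
  let ?u = "{i,j,k,l,m}"
  have off: "contrib t b x = 0" if t4: "card t = 4" and nb: "\<not> b \<subseteq> t" for t and x :: "'f::field \<times> 'f"
  proof -
    obtain i j k l where o: "i < j" "j < k" "k < l" and t: "t = {i,j,k,l}"
      using t4 by (rule card_four_ordered)
    have "b \<noteq> {i,j}" "b \<noteq> {i,k}" "b \<noteq> {i,l}" "b \<noteq> {j,k}" "b \<noteq> {j,l}" "b \<noteq> {k,l}"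
      using nb t by auto
    then show ?thesis using o by (simp add: t contrib_ordered)
  qed
  have o2: "i < k" "i < l" "i < m" "j < l" "j < m" "k < m" using assms by auto
  have ne: "i \<noteq> j" "i \<noteq> k" "i \<noteq> l" "i \<noteq> m" "j \<noteq> k" "j \<noteq> l" "j \<noteq> m" "k \<noteq> l" "k \<noteq> m" "l \<noteq> m"
    using assms(1-4) o2 by auto
  have d: "?u - {i} = {j,k,l,m}" "?u - {j} = {i,k,l,m}" "?u - {k} = {i,j,l,m}"
    "?u - {l} = {i,j,k,m}" "?u - {m} = {i,j,k,l}" using assms o2 by auto
  have cd: "card (?u - {vtx ?u n}) = 4" if "n \<in> {1..5}" for n
  proof -
    have "n \<in> {1,2,3,4,5}" using that by auto
    then show ?thesis using ne by (elim insertE emptyE) (simp_all add: vtx_five assms(1-4) d)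
  qed
  have "edge_functional ?u b z = (\<Sum>n\<in>{1..5}. (- 1) ^ (n + 1) * contrib (?u - {vtx ?u n}) b (z (?u - {vtx ?u n})))"
    unfolding edge_functional_def
    by (rule sum.mono_neutral_left) (auto simp: off cd)
  also have "{1..5::nat} = {1,2,3,4,5}" by auto
  finally show ?thesis using assms o2 by (simp add: vtx_five d)
qed

text \<open>
  Edge vectors are permitted: each of the ten functionals vanishes identically in the values of the cochain.
\<close>

lemma edge_functional_cochain_color:
  assumes "card u = 5" "b \<subseteq> u" "card b = 2"
  shows "edge_functional u b (cochain_color c) = 0"
proof -
  obtain i j k l m where o: "i < j" "j < k" "k < l" "l < m" and t: "u = {i,j,k,l,m}"
    using assms(1) by (rule card_five_ordered)
  have o2: "i < k" "i < l" "i < m" "j < l" "j < m" "k < m" using o by auto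
  have ne: "i \<noteq> j" "i \<noteq> k" "i \<noteq> l" "i \<noteq> m" "j \<noteq> k" "j \<noteq> l" "j \<noteq> m" "k \<noteq> l" "k \<noteq> m" "l \<noteq> m"
    using o o2 by auto
  note cc = contrib_ordered[OF o(2,3,4)] contrib_ordered[OF o2(1) o(3,4)] contrib_ordered[OF o(1) o2(4) o(4)]
    contrib_ordered[OF o(1,2) o2(6)] contrib_ordered[OF o(1,2,3)]
    and ee = cochain_color_ordered[OF o(2,3,4)] cochain_color_ordered[OF o2(1) o(3,4)] cochain_color_ordered[OF o(1) o2(4) o(4)]
    cochain_color_ordered[OF o(1,2) o2(6)] cochain_color_ordered[OF o(1,2,3)]
  have "b \<in> {{i,j},{i,k},{i,l},{i,m},{j,k},{j,l},{j,m},{k,l},{k,m},{l,m}}"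
    by (rule edges_of_five[OF o]) (use assms(2,3) t in auto)
  then show ?thesis
    unfolding t edge_functional_ordered[OF o assms(3)] cc ee
    by (elim insertE emptyE)
      (simp_all add: doubleton_eq_iff ne ne[symmetric])
qed

text \<open>
  The colorings of a pentachoron have dimension ten.  The vanishing of five edge functionals already
  expresses them in terms of five free parameters, and these parameters can be prescribed by the values of a
  cochain on five suitable edges.
\<close>

lemma pentachoron_permitted_cochain:
  assumes "card u = 5" "\<And>b. b \<subseteq> u \<Longrightarrow> card b = 2 \<Longrightarrow> edge_functional u b z = 0"
  obtains c where "\<And>t. t \<subseteq> u \<Longrightarrow> card t = 4 \<Longrightarrow> z t = cochain_color c t"
proof -
  obtain i j k l m where o: "i < j" "j < k" "k < l" "l < m" and u: "u = {i,j,k,l,m}"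
    using assms(1) by (rule card_five_ordered)
  have o2: "i < k" "i < l" "i < m" "j < l" "j < m" "k < m" using o by auto
  have ne: "i \<noteq> j" "i \<noteq> k" "i \<noteq> l" "i \<noteq> m" "j \<noteq> k" "j \<noteq> l" "j \<noteq> m" "k \<noteq> l" "k \<noteq> m" "l \<noteq> m"
    using o o2 by auto
  note cc = contrib_ordered[OF o(2,3,4)] contrib_ordered[OF o2(1) o(3,4)] contrib_ordered[OF o(1) o2(4) o(4)]
    contrib_ordered[OF o(1,2) o2(6)] contrib_ordered[OF o(1,2,3)]
    and ee = cochain_color_ordered[OF o(2,3,4)] cochain_color_ordered[OF o2(1) o(3,4)] cochain_color_ordered[OF o(1) o2(4) o(4)]
    cochain_color_ordered[OF o(1,2) o2(6)] cochain_color_ordered[OF o(1,2,3)]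
  obtain x1 y1 x2 y2 x3 y3 x4 y4 x5 y5 where zz:
    "z {j,k,l,m} = (x1,y1)" "z {i,k,l,m} = (x2,y2)" "z {i,j,l,m} = (x3,y3)"
    "z {i,j,k,m} = (x4,y4)" "z {i,j,k,l} = (x5,y5)" by (meson surj_pair)
  have E: "b \<subseteq> u \<Longrightarrow> card b = 2 \<Longrightarrow> contrib {j,k,l,m} b (z {j,k,l,m})
    - contrib {i,k,l,m} b (z {i,k,l,m}) + contrib {i,j,l,m} b (z {i,j,l,m})
    - contrib {i,j,k,m} b (z {i,j,k,m}) + contrib {i,j,k,l} b (z {i,j,k,l}) = 0" for b
    using assms(2)[of b] edge_functional_ordered[OF o, of b z] u by simp
  \<comment> \<open>The equations of five edges determine five components of the colors by the other five.\<close>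
  have 1: "y3 - y4 + y5 = 0" 
    using E[of "{i,j}"] ne ne[symmetric] by (simp add: u cc doubleton_eq_iff zz)
  have 2: "y2 = (x5 - y5) - (x4 - y4)"
    using E[of "{i,k}"] ne ne[symmetric] by (simp add: u cc doubleton_eq_iff zz algebra_simps)
  have 3: "x2 = y2 + x3 - y3 - x5"
    using E[of "{i,l}"] ne ne[symmetric] by (simp add: u cc doubleton_eq_iff zz algebra_simps)
  have 4: "y1 = x5 - x4"
    using E[of "{j,k}"] ne ne[symmetric] by (simp add: u cc doubleton_eq_iff zz algebra_simps)
  have 5: "x1 = y1 - x5 - y5 + x3"
    using E[of "{j,l}"] ne ne[symmetric] by (simp add: u cc doubleton_eq_iff zz algebra_simps)
  have 6: "y3 = y4 - y5" using 1 by (simp add: algebra_simps add_eq_0_iff)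
  have 7: "y2 = x5 - y5 - x4 + y4" using 2 by (simp add: algebra_simps)
  have 8: "x2 = x3 - x4" by (simp add: 3 6 7)
  have 9: "x1 = x3 - x4 - y5" by (simp add: 5 4)
  \<comment> \<open>The witness is normalized to vanish on the edges at \<open>i\<close> and on \<open>{j,k}\<close>.  The colors of \<open>ijkl\<close>, \<open>ijkm\<close>
    and \<open>ijlm\<close> then give its values on the other five edges.\<close>
  let ?c = "\<lambda>b. if b = {j,l} then y5 else if b = {k,l} then y5 - x5 else if b = {j,m} then y4
    else if b = {k,m} then y4 - x4 else if b = {l,m} then y4 - x3 else 0"
  have "z t = cochain_color ?c t" if "t \<subseteq> u" "card t = 4" for t
  proof -
    have "t \<in> {{j,k,l,m},{i,k,l,m},{i,j,l,m},{i,j,k,m},{i,j,k,l}}"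
      using four_subsets_of_five[OF o] that u by simp
    then show ?thesis using 6 7 8 9 4
      by (elim insertE emptyE)
       (simp_all add: zz ee doubleton_eq_iff ne ne[symmetric] algebra_simps)
  qed
  then show ?thesis using that by blast
qed


section \<open>Edge-generated colorings of a complex\<close>

lemma edge_functional_cong:
  assumes "card u = 5" "\<And>t. t \<subseteq> u \<Longrightarrow> card t = 4 \<Longrightarrow> z t = z' t"
  shows "edge_functional u b z = edge_functional u b z'"
  unfolding edge_functional_def
proof (rule sum.cong[OF refl])
  fix m assume "m \<in> {m \<in> {1..5}. b \<subseteq> u - {vtx u m}}"
  then have "vtx u m \<in> u" using assms(1) by (intro vtx_mem) auto
  then have "z (u - {vtx u m}) = z' (u - {vtx u m})" using assms by simp
  then show "(- 1) ^ (m + 1) * contrib (u - {vtx u m}) b (z (u - {vtx u m}))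
    = (- 1) ^ (m + 1) * contrib (u - {vtx u m}) b (z' (u - {vtx u m}))" by simp
qed

lemma contrib_linear:
  "contrib t b (p + q) = contrib t b p + contrib t b q"
  "contrib t b (a * fst p, a * snd p) = a * contrib t b p"
  unfolding contrib_def split_beta by (simp_all add: algebra_simps)

lemma edge_functional_linear:
  "edge_functional u b (z + z') = edge_functional u b z + edge_functional u b z'"
  "edge_functional u b (cscale a z) = a * edge_functional u b z"
  by (simp_all add: edge_functional_def cscale_def contrib_linear sum.distrib[symmetric] sum_distrib_left
      distrib_left mult.left_commute)

lemma subspace_permitted: "col.subspace (permitted K :: ('v::linorder, 'f::field) coloring set)"
proof (rule col.subspaceI)
  have "edge_functional u b (0 :: ('v, 'f) coloring) = 0" for u b :: "'v set"
    using edge_functional_linear(2)[of u b 0 "0 :: ('v, 'f) coloring"] by simp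
  then show "(0 :: ('v, 'f) coloring) \<in> permitted K" by (simp add: permitted_def colorings_def)
next
  fix z z' :: "('v, 'f) coloring" and a
  assume z: "z \<in> permitted K"
  have "cscale a z t = 0" if "z t = 0" for t using that by (simp add: cscale_def zero_prod_def)
  then show "cscale a z \<in> permitted K"
    using z by (simp add: permitted_def colorings_def edge_functional_linear)
  assume "z' \<in> permitted K"
  then show "z + z' \<in> permitted K"
    using z by (simp add: permitted_def colorings_def edge_functional_linear)
qed

lemma abstract_complexD:
  assumes "abstract_complex K"
  shows "finite K" "s \<in> K \<Longrightarrow> finite s" "s \<in> K \<Longrightarrow> r \<subseteq> s \<Longrightarrow> r \<noteq> {} \<Longrightarrow> r \<in> K"
  using assms unfolding abstract_complex_def by blast+

lemma tetrahedra_faceI: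
  assumes "abstract_complex K" "s \<in> K" "t \<subseteq> s" "card t = 4" shows "t \<in> tetrahedra K"
  using abstract_complexD(3)[OF assms(1-3)] assms(4) by (cases "t = {}") (auto simp: tetrahedra_def)

lemma edges_faceI:
  assumes "abstract_complex K" "s \<in> K" "t \<subseteq> s" "card t = 2" shows "t \<in> edges K"
  using abstract_complexD(3)[OF assms(1-3)] assms(4) by (cases "t = {}") (auto simp: edges_def)

lemma permitted_restr_cochain_color:
  assumes "abstract_complex K" shows "restr K (cochain_color c) \<in> permitted K"
proof -
  have "edge_functional u b (restr K (cochain_color c)) = 0"
    if "u \<in> pentachora K" "b \<subseteq> u" "card b = 2" for u b
  proof -
    have u: "u \<in> K" "card u = 5" using that by (auto simp: pentachora_def)
    have "edge_functional u b (restr K (cochain_color c)) = edge_functional u b (cochain_color c)"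
      by (rule edge_functional_cong) (auto simp: u restr_def tetrahedra_faceI[OF assms u(1)])
    then show ?thesis using edge_functional_cochain_color u that by simp
  qed
  then show ?thesis by (auto simp: permitted_def colorings_def restr_def)
qed

abbreviation edge_cochain :: "'v set \<Rightarrow> 'v set \<Rightarrow> 'f::field" where
  "edge_cochain b \<equiv> (\<lambda>b'. if b' = b then 1 else 0)"

lemma cochain_color_edge_cochain:
  assumes "card t = 4" "card b = 2"
  shows "cochain_color (edge_cochain b) t = (if b \<subseteq> t then edge_color t b else 0)"
proof (cases "b \<subseteq> t")
  case False
  then have "cochain_color (edge_cochain b) t = cochain_color (\<lambda>b. 0) t"
    by (intro cochain_color_cong assms(1)) auto
  then show ?thesis using False by (simp add: cochain_color_zero)
next
  case True
  obtain i j k l where o: "i < j" "j < k" "k < l" and t: "t = {i,j,k,l}"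
    using assms(1) by (rule card_four_ordered)
  have ne: "i \<noteq> j" "i \<noteq> k" "i \<noteq> l" "j \<noteq> k" "j \<noteq> l" "k \<noteq> l" using o by auto
  have "b = {i,j} \<or> b = {i,k} \<or> b = {i,l} \<or> b = {j,k} \<or> b = {j,l} \<or> b = {k,l}"
    by (rule edges_of_four[OF o]) (use True assms(2) t in auto)
  then show ?thesis using True unfolding t cochain_color_ordered[OF o]
    by (elim disjE) (simp_all add: edge_color_def vtx_four[OF o] doubleton_eq_iff ne ne[symmetric])
qed

lemma edge_color_nonzero:
  assumes "card t = 4" "card b = 2" "b \<subseteq> t"
  shows "edge_color t b \<noteq> (0 :: 'f::field \<times> 'f)"
proof -
  obtain i j k l where o: "i < j" "j < k" "k < l" and t: "t = {i,j,k,l}"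
    using assms(1) by (rule card_four_ordered)
  have ne: "i \<noteq> j" "i \<noteq> k" "i \<noteq> l" "j \<noteq> k" "j \<noteq> l" "k \<noteq> l" using o by auto
  have "b = {i,j} \<or> b = {i,k} \<or> b = {i,l} \<or> b = {j,k} \<or> b = {j,l} \<or> b = {k,l}"
    by (rule edges_of_four[OF o]) (use assms t in auto)
  then show ?thesis unfolding t
    by (elim disjE) (simp_all add: edge_color_def vtx_four[OF o] doubleton_eq_iff ne ne[symmetric] zero_prod_def)
qed

text \<open>
  Recovers a coefficient from a color to which one edge only contributes.
\<close>

lemma cochain_color_single_edge:
  assumes t: "card t = 4" and b: "b \<subseteq> t" "card b = 2" and c: "cochain_color c t = 0"
    and others: "\<And>b'. b' \<subseteq> t \<Longrightarrow> card b' = 2 \<Longrightarrow> b' \<noteq> b \<Longrightarrow> c b' = 0"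
  shows "c b = (0 :: 'f::field)"
proof -
  \<comment> \<open>The cochain is written in the shape to which \<open>cochain_color_diff\<close> applies.\<close>
  have "cochain_color c t = cochain_color (\<lambda>b'. 0 - (- c b) * edge_cochain b b') t"
    by (rule cochain_color_cong[OF t]) (use others in auto)
  also have "\<dots> = cscale (c b) (edge_color t) b"
    unfolding cochain_color_diff 
    by (simp add: cochain_color_zero cscale_def cochain_color_edge_cochain[OF t b(2)] b(1) zero_prod_def)
  finally have "c b * fst (edge_color t b :: 'f \<times> 'f) = 0" "c b * snd (edge_color t b :: 'f \<times> 'f) = 0"
    using c by (auto simp: cscale_def zero_prod_def)
  then show ?thesis using edge_color_nonzero[OF t b(2,1), where 'f = 'f]
    by (auto simp: prod_eq_iff)
qed

lemma edge_vector_cochain_color: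
  "card b = 2 \<Longrightarrow> edge_vector K b = restr K (cochain_color (edge_cochain b))"
  by (rule ext) (simp add: edge_vector_def restr_def tetrahedra_def cochain_color_edge_cochain)

lemma restr_cochain_color_linear:
  "restr K (cochain_color (\<lambda>b. c b + d b)) = restr K (cochain_color c) + restr K (cochain_color d)"
  "restr K (cochain_color (\<lambda>b. a * c b)) = cscale a (restr K (cochain_color c))"
  by (rule ext, simp add: restr_def cochain_color_def cscale_def algebra_simps zero_prod_def)+

lemma restr_cochain_color_cong:
  assumes "abstract_complex K" "\<And>b. b \<in> edges K \<Longrightarrow> c b = d b"
  shows "restr K (cochain_color c) = restr K (cochain_color d)"
proof
  fix t show "restr K (cochain_color c) t = restr K (cochain_color d) t"
  proof (cases "t \<in> tetrahedra K")
    case True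
    then have t: "t \<in> K" "card t = 4" by (auto simp: tetrahedra_def)
    have "cochain_color c t = cochain_color d t"
      by (rule cochain_color_cong[OF t(2)]) (use edges_faceI[OF assms(1) t(1)] assms(2) in blast)
    then show ?thesis by (simp add: restr_def)
  qed (simp add: restr_def)
qed

lemma finite_edges: "abstract_complex K \<Longrightarrow> finite (edges K)"
  by (simp add: edges_def abstract_complexD)

text \<open>
  A 1-cochain is thus a family of coefficients of edge vectors.
\<close>

lemma restr_cochain_color_sum:
  assumes "finite E" "\<And>b. b \<in> E \<Longrightarrow> card b = 2"
  shows "restr K (cochain_color (\<lambda>b. if b \<in> E then c b else 0)) = (\<Sum>b\<in>E. cscale (c b) (edge_vector K b))"
  using assms
proof (induction E rule: finite_induct)
  case empty
  then show ?case by (auto simp: restr_def cochain_color_zero)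
next
  case (insert e E)
  have "(\<lambda>b. if b \<in> insert e E then c b else 0) =
    (\<lambda>b. c e * edge_cochain e b + (if b \<in> E then c b else 0))" using insert.hyps by auto
  then have "restr K (cochain_color (\<lambda>b. if b \<in> insert e E then c b else 0)) =
    cscale (c e) (edge_vector K e) + restr K (cochain_color (\<lambda>b. if b \<in> E then c b else 0))"
    using insert.prems by (simp only: restr_cochain_color_linear edge_vector_cochain_color insertI1)
  then show ?case using insert by simp
qed

text \<open>
  Elements of a span of edge vectors are represented by cochains on all vertex sets, of which only
  the values on edges of the complex matter.  This allows one cochain to serve for several complexes.
\<close>

lemma span_edge_vectors:
  fixes K :: "'v::linorder complex"
  assumes K: "abstract_complex K" and E: "E \<subseteq> edges K"
  shows "(col.span (edge_vector K ` E) :: ('v, 'f::field) coloring set) =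
    {restr K (cochain_color c) |c. \<forall>b \<in> edges K - E. c b = 0}" (is "_ = ?S")
proof
  show "col.span (edge_vector K ` E) \<subseteq> ?S"
  proof (rule col.span_minimal)
    show "edge_vector K ` E \<subseteq> ?S"
    proof
      fix z :: "('v, 'f) coloring" assume "z \<in> edge_vector K ` E"
      then obtain b where b: "b \<in> E" "z = edge_vector K b" by auto
      then have "z = restr K (cochain_color (edge_cochain b))"
        using E edge_vector_cochain_color[of b K] by (auto simp: edges_def)
      moreover have "\<forall>b' \<in> edges K - E. edge_cochain b b' = 0" using b by auto
      ultimately show "z \<in> ?S" by blast
    qed
    show "col.subspace ?S"
    proof (rule col.subspaceI)
      have "0 = restr K (cochain_color (\<lambda>b. 0))" by (auto simp: restr_def cochain_color_zero)
      then show "0 \<in> ?S" by fastforce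
    next
      fix x y assume "x \<in> ?S" "y \<in> ?S"
      then obtain c d where cd: "x = restr K (cochain_color c)" "y = restr K (cochain_color d)"
        "\<forall>b \<in> edges K - E. c b = 0" "\<forall>b \<in> edges K - E. d b = 0" by blast
      then show "x + y \<in> ?S"
        by (intro CollectI exI[of _ "\<lambda>b. c b + d b"]) (simp add: restr_cochain_color_linear)
    next
      fix a x assume "x \<in> ?S"
      then obtain c where "x = restr K (cochain_color c)" "\<forall>b \<in> edges K - E. c b = 0" by blast
      then show "cscale a x \<in> ?S"
        by (intro CollectI exI[of _ "\<lambda>b. a * c b"]) (simp add: restr_cochain_color_linear)
    qed
  qed
  show "?S \<subseteq> col.span (edge_vector K ` E)"
  proof
    fix z assume "z \<in> ?S"
    then obtain c where c: "z = restr K (cochain_color c)" "\<forall>b \<in> edges K - E. c b = 0" by blast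
    have "z = restr K (cochain_color (\<lambda>b. if b \<in> E then c b else 0))"
      unfolding c(1) by (rule restr_cochain_color_cong[OF K]) (use c(2) in auto)
    also have "\<dots> = (\<Sum>b\<in>E. cscale (c b) (edge_vector K b))"
      by (rule restr_cochain_color_sum)
       (use E finite_edges[OF K] in \<open>auto simp: edges_def intro: finite_subset\<close>)
    also have "\<dots> \<in> col.span (edge_vector K ` E)"
      by (intro col.span_sum col.span_scale col.span_base) auto
    finally show "z \<in> col.span (edge_vector K ` E)" .
  qed
qed

text \<open>
  The hypothesis says that the edge vectors of \<open>E\<close> are linearly independent.
  In particular they are distinct, so that the image of \<open>E\<close> has as many elements as \<open>E\<close>.
\<close>

lemma dim_span_edge_vectors:
  fixes K :: "'v::linorder complex"
  assumes K: "abstract_complex K" and E: "E \<subseteq> edges K"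
    and inj: "\<And>(c :: 'v set \<Rightarrow> 'f::field) b. (\<And>b. b \<in> edges K - E \<Longrightarrow> c b = 0) \<Longrightarrow> restr K (cochain_color c) = 0
      \<Longrightarrow> b \<in> E \<Longrightarrow> c b = 0"
  shows "col.dim (col.span (edge_vector K ` E) :: ('v, 'f) coloring set) = card E"
proof -
  let ?e = "edge_vector K :: 'v set \<Rightarrow> ('v, 'f) coloring"
  have finE: "finite E" using finite_edges[OF K] E finite_subset by blast
  have card2: "card b = 2" if "b \<in> E" for b using that E by (auto simp: edges_def)
  have injE: "inj_on ?e E"
  proof (rule inj_onI, rule ccontr)
    fix b b' assume b: "b \<in> E" "b' \<in> E" "?e b = ?e b'" "b \<noteq> b'"
    let ?c = "\<lambda>s. edge_cochain b s + - 1 * edge_cochain b' s :: 'f"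
    have "restr K (cochain_color ?c) = ?e b + cscale (- 1) (?e b')"
      unfolding restr_cochain_color_linear using b card2 by (simp only: edge_vector_cochain_color)
    then have "restr K (cochain_color ?c) = 0" using b(3) by simp
    then have "?c b = 0" by (rule inj[rotated]) (use b in auto)
    then show False using b(4) by simp
  qed
  have "col.independent (?e ` E)"
  proof (rule col.independent_if_scalars_zero)
    fix f x assume f: "(\<Sum>x\<in>?e ` E. cscale (f x) x) = 0" and "x \<in> ?e ` E"
    then obtain b where b: "b \<in> E" "x = ?e b" by auto
    let ?c = "\<lambda>b. if b \<in> E then f (?e b) else 0"
    have "restr K (cochain_color ?c) = (\<Sum>b\<in>E. cscale (f (?e b)) (?e b))"
      by (rule restr_cochain_color_sum[OF finE card2])
    also have "\<dots> = 0" using f by (simp add: sum.reindex[OF injE])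
    finally have "?c b = 0" by (rule inj[rotated]) (use b in auto)
    then show "f x = 0" using b by simp
  qed (use finE in simp)
  then show ?thesis by (simp add: col.dim_span col.dim_eq_card_independent card_image[OF injE])
qed

lemma edge_generated_eq:
  "abstract_complex K \<Longrightarrow> edge_generated K = range (\<lambda>c. restr K (cochain_color c))"
  unfolding edge_generated_def by (subst span_edge_vectors) auto

lemma boundary_subset: "abstract_complex K \<Longrightarrow> boundary K \<subseteq> K"
  by (auto simp: boundary_def faces_def tetrahedra_def abstract_complex_def)

lemma boundary_faceI: "s \<in> boundary K \<Longrightarrow> r \<subseteq> s \<Longrightarrow> r \<noteq> {} \<Longrightarrow> r \<in> boundary K"
  unfolding boundary_def faces_def by blast

lemma abstract_boundary:
  assumes "abstract_complex K" shows "abstract_complex (boundary K)"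
proof -
  have "s \<in> K" if "s \<in> boundary K" for s using boundary_subset[OF assms] that by blast
  moreover have "finite (boundary K)"
    by (rule finite_subset[OF boundary_subset[OF assms] abstract_complexD(1)[OF assms]])
  moreover have "s \<noteq> {}" if "s \<in> boundary K" for s using that by (simp add: boundary_def faces_def)
  ultimately show ?thesis
    using abstract_complexD(2)[OF assms] boundary_faceI unfolding abstract_complex_def by blast
qed

text \<open>
  Every edge of a boundary tetrahedron lies in the boundary, so inner edges contribute nothing there.
\<close>

lemma restr_inner_edges_mem_permitted_rel:
  assumes K: "abstract_complex K" and c: "\<forall>b \<in> edges K - inner_edges K. c b = 0"
  shows "restr K (cochain_color c) \<in> permitted_rel K"
proof -
  have "restr K (cochain_color c) t = 0" if t: "t \<in> tetrahedra (boundary K)" for t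
  proof -
    have t': "t \<in> boundary K" "card t = 4" using t by (auto simp: tetrahedra_def)
    have "cochain_color c t = cochain_color (\<lambda>b. 0) t"
    proof (rule cochain_color_cong[OF t'(2)])
      fix b assume "b \<subseteq> t" "card b = 2"
      then have "b \<in> edges (boundary K)" using edges_faceI[OF abstract_boundary[OF K] t'(1)] by blast
      then have "b \<in> edges K - inner_edges K"
        using boundary_subset[OF K] by (auto simp: inner_edges_def edges_def)
      then show "c b = 0" using c by blast
    qed
    then show ?thesis by (simp add: restr_def cochain_color_zero)
  qed
  then show ?thesis using permitted_restr_cochain_color[OF K] by (auto simp: permitted_rel_def)
qed


section \<open>The two sides of a four-dimensional Pachner move\<close>

text \<open>
  The subcomplex formed by the pentachora opposite to the vertices in \<open>I\<close>: a simplex lies in the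
  pentachoron opposite to \<open>i\<close> if and only if it avoids \<open>i\<close>.
  The other side is the same construction for \<open>D - I\<close>.
\<close>

definition pachner_side :: "'v set \<Rightarrow> 'v set \<Rightarrow> 'v complex" where
  "pachner_side D I = {s. s \<noteq> {} \<and> s \<subseteq> D \<and> \<not> I \<subseteq> s}"

lemma faces_opposite_pentachora: "I \<subseteq> D \<Longrightarrow> faces ((\<lambda>i. D - {i}) ` I) = pachner_side D I"
  by (auto simp: faces_def pachner_side_def)

lemma abstract_pachner_side: "finite D \<Longrightarrow> abstract_complex (pachner_side D I)"
proof -
  assume "finite D"
  moreover have "pachner_side D I \<subseteq> Pow D" by (auto simp: pachner_side_def)
  ultimately have "finite (pachner_side D I)" by (meson finite_Pow_iff finite_subset)
  then show ?thesis using \<open>finite D\<close>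
    by (auto simp: abstract_complex_def pachner_side_def intro: finite_subset)
qed

lemma five_subset_of_six:
  assumes "card D = 6" "u \<subseteq> D" "card u = 5"
  obtains i where "i \<in> D" "u = D - {i}"
proof -
  have "finite D" using assms(1) card.infinite by fastforce
  then have "card (D - u) = 1" using assms by (simp add: card_Diff_subset finite_subset)
  then obtain i where "D - u = {i}" by (auto simp: card_1_singleton_iff)
  then have "i \<in> D" "u = D - {i}" using assms(2) by auto
  then show ?thesis using that by blast
qed

lemma four_subset_of_six:
  assumes "card D = 6" "t \<subseteq> D" "card t = 4"
  obtains i j where "i \<in> D" "j \<in> D" "i \<noteq> j" "t = D - {i,j}"
proof -
  have "finite D" using assms(1) card.infinite by fastforce
  then have "card (D - t) = 2" using assms by (simp add: card_Diff_subset finite_subset)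
  then obtain i j where "D - t = {i,j}" "i \<noteq> j" by (auto simp: card_2_iff)
  then have "i \<in> D" "j \<in> D" "t = D - {i,j}" using assms(2) by auto
  then show ?thesis using that \<open>i \<noteq> j\<close> by blast
qed

lemma six_minus_two:
  assumes "card D = 6" "i \<in> D" "j \<in> D" "i \<noteq> j" shows "card (D - {i,j}) = 4"
  using assms card.infinite[of D] by (cases "finite D") (simp_all add: card_Diff_subset)

lemma pentachora_pachner_side:
  assumes "card D = 6" "I \<subseteq> D"
  shows "pentachora (pachner_side D I) = (\<lambda>i. D - {i}) ` I"
proof
  show "pentachora (pachner_side D I) \<subseteq> (\<lambda>i. D - {i}) ` I"
  proof
    fix u assume "u \<in> pentachora (pachner_side D I)"
    then have u: "u \<subseteq> D" "card u = 5" "\<not> I \<subseteq> u" by (auto simp: pentachora_def pachner_side_def)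
    obtain i where "i \<in> D" "u = D - {i}" using assms(1) u(1,2) by (rule five_subset_of_six)
    then show "u \<in> (\<lambda>i. D - {i}) ` I" using u(3) assms(2) by auto
  qed
  show "(\<lambda>i. D - {i}) ` I \<subseteq> pentachora (pachner_side D I)"
  proof
    fix u assume "u \<in> (\<lambda>i. D - {i}) ` I"
    then obtain i where i: "i \<in> I" "u = D - {i}" by auto
    then have "card u = 5" using assms by auto
    then have "u \<noteq> {}" by auto
    then have "u \<in> pachner_side D I" using i assms(2) by (auto simp: pachner_side_def)
    then show "u \<in> pentachora (pachner_side D I)" 
      using \<open>card u = 5\<close> by (auto simp: pentachora_def)
  qed
qed

lemma tetrahedra_pachner_side: "tetrahedra (pachner_side D I) = {t. t \<subseteq> D \<and> card t = 4 \<and> \<not> I \<subseteq> t}"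
  by (auto simp: tetrahedra_def pachner_side_def)

lemma edges_pachner_side: "edges (pachner_side D I) = {b. b \<subseteq> D \<and> card b = 2 \<and> \<not> I \<subseteq> b}"
  by (auto simp: edges_def pachner_side_def)

text \<open>
  The tetrahedron \<open>D - {i,j}\<close> lies in the pentachora opposite to \<open>i\<close> and to \<open>j\<close> only.  It is therefore in the boundary if
  and only if exactly one of \<open>i\<close> and \<open>j\<close> belongs to \<open>I\<close>.  The resulting description is symmetric in the two sides.
\<close>

lemma boundary_pachner_side:
  assumes D: "card D = 6" and I: "I \<subseteq> D"
  shows "boundary (pachner_side D I) = {s. s \<noteq> {} \<and> s \<subseteq> D \<and> \<not> I \<subseteq> s \<and> \<not> D - I \<subseteq> s}"
    (is "_ = ?B")
proof -
  have fin: "finite D" using D card.infinite by fastforce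
  have cofaces: "card {u \<in> pentachora (pachner_side D I). t \<subseteq> u} = card (I - t)" if "t \<subseteq> D" for t
  proof -
    have "{u \<in> pentachora (pachner_side D I). t \<subseteq> u} = (\<lambda>i. D - {i}) ` (I - t)"
      using that by (auto simp: pentachora_pachner_side[OF D I])
    moreover have "inj_on (\<lambda>i. D - {i}) (I - t)" using I by (auto simp: inj_on_def)
    ultimately show ?thesis by (simp add: card_image)
  qed
  have sep: "card (I - t) = 1 \<longleftrightarrow> \<not> I \<subseteq> t \<and> \<not> D - I \<subseteq> t" if t: "t \<subseteq> D" "card t = 4" for t
  proof -
    obtain i j where ij: "i \<in> D" "j \<in> D" "i \<noteq> j" "t = D - {i,j}" using D t by (rule four_subset_of_six)
    have e: "I - t = I \<inter> {i,j}" "I \<subseteq> t \<longleftrightarrow> i \<notin> I \<and> j \<notin> I" "D - I \<subseteq> t \<longleftrightarrow> i \<in> I \<and> j \<in> I"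
      using I ij by auto
    show ?thesis unfolding e using ij(3) by (cases "i \<in> I"; cases "j \<in> I") simp_all
  qed
  show ?thesis
  proof
    show "boundary (pachner_side D I) \<subseteq> ?B"
    proof
      fix s assume "s \<in> boundary (pachner_side D I)"
      then obtain t where t: "s \<noteq> {}" "s \<subseteq> t" "t \<subseteq> D" "card t = 4"
        "card {u \<in> pentachora (pachner_side D I). t \<subseteq> u} = 1"
        by (auto simp: boundary_def faces_def tetrahedra_def pachner_side_def)
      then show "s \<in> ?B" using cofaces sep by auto
    qed
    show "?B \<subseteq> boundary (pachner_side D I)"
    proof
      fix s assume s: "s \<in> ?B"
      then obtain i j where ij: "i \<in> I" "i \<notin> s" "j \<in> D" "j \<notin> I" "j \<notin> s" by auto
      let ?t = "D - {i,j}"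
      have "i \<noteq> j" "i \<in> D" using ij I by auto
      then have c: "card ?t = 4" using D fin ij by (simp add: card_Diff_subset)
      then have "?t \<noteq> {}" by force
      then have "?t \<in> tetrahedra (pachner_side D I)"
        using c ij by (auto simp: tetrahedra_def pachner_side_def)
      moreover have "card {u \<in> pentachora (pachner_side D I). ?t \<subseteq> u} = 1"
        using cofaces[of ?t] sep[of ?t] c ij by auto
      moreover have "s \<subseteq> ?t" using s ij by auto
      ultimately show "s \<in> boundary (pachner_side D I)"
        using s unfolding boundary_def faces_def by blast
    qed
  qed
qed

lemma tetrahedra_boundary_pachner_side:
  assumes "card D = 6" "I \<subseteq> D"
  shows "tetrahedra (boundary (pachner_side D I)) = {t. t \<subseteq> D \<and> card t = 4 \<and> \<not> I \<subseteq> t \<and> \<not> D - I \<subseteq> t}"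
  by (auto simp: tetrahedra_def boundary_pachner_side[OF assms])

lemma inner_edges_pachner_side:
  assumes "card D = 6" "I \<subseteq> D"
  shows "inner_edges (pachner_side D I) = {b. b \<subseteq> D \<and> card b = 2 \<and> \<not> I \<subseteq> b \<and> D - I \<subseteq> b}"
  unfolding inner_edges_def edges_def boundary_pachner_side[OF assms] by (auto simp: pachner_side_def)

text \<open>
  A side is a cone whose apex \<open>v\<close> is any vertex outside \<open>I\<close>, as all its pentachora contain \<open>v\<close>.
  This is what makes the cochains found on the single pentachora fit together.
\<close>

lemma permitted_side_cochain_color:
  fixes z :: "('v::linorder, 'f::field) coloring"
  assumes D: "card D = 6" and I: "I \<subseteq> D" "I \<noteq> {}" "I \<noteq> D"
    and z: "z \<in> permitted (pachner_side D I)"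
  obtains c where "z = restr (pachner_side D I) (cochain_color c)"
proof -
  have fin: "finite D" using D card.infinite by fastforce
  obtain v where v: "v \<in> D" "v \<notin> I" using I by auto
  obtain i0 where i0: "i0 \<in> I" using I by auto
  have c4: "card (D - {i,j}) = 4" if "i \<in> I" "j \<in> I" "i \<noteq> j" for i j
  proof -
    have "{i,j} \<subseteq> D" using that I by auto
    then show ?thesis using that D fin by (simp add: card_Diff_subset)
  qed
  have "\<exists>c. (\<forall>x. x \<noteq> v \<longrightarrow> c {v,x} = 0) \<and> (\<forall>t. t \<subseteq> D - {i} \<longrightarrow> card t = 4 \<longrightarrow> z t = cochain_color c t)"
    if i: "i \<in> I" for i
  proof -
    have "D - {i} \<in> pentachora (pachner_side D I)" using i by (simp add: pentachora_pachner_side[OF D I(1)])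
    then obtain c where c: "\<And>t. t \<subseteq> D - {i} \<Longrightarrow> card t = 4 \<Longrightarrow> z t = cochain_color c t"
      using pentachoron_permitted_cochain[of "D - {i}" z] z by (auto simp: permitted_def pentachora_def)
    obtain d where "\<And>x. x \<noteq> v \<Longrightarrow> d {v,x} = 0" "\<And>t. card t = 4 \<Longrightarrow> cochain_color d t = cochain_color c t"
      by (rule gauge_fix[of v c]) blast
    then show ?thesis using c by (intro exI[of _ d]) auto
  qed
  then have "\<forall>i\<in>I. \<exists>c. (\<forall>x. x \<noteq> v \<longrightarrow> c {v,x} = 0) \<and> (\<forall>t. t \<subseteq> D - {i} \<longrightarrow> card t = 4 \<longrightarrow> z t = cochain_color c t)"
    by blast
  then obtain c0 where c0: "\<forall>i\<in>I. (\<forall>x. x \<noteq> v \<longrightarrow> c0 i {v,x} = 0) \<and>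
      (\<forall>t. t \<subseteq> D - {i} \<longrightarrow> card t = 4 \<longrightarrow> z t = cochain_color (c0 i) t)"
    by (rule bchoice[THEN exE])
  have c0g: "\<And>i x. i \<in> I \<Longrightarrow> x \<noteq> v \<Longrightarrow> c0 i {v,x} = 0"
    and c0z: "\<And>i t. i \<in> I \<Longrightarrow> t \<subseteq> D - {i} \<Longrightarrow> card t = 4 \<Longrightarrow> z t = cochain_color (c0 i) t"
    using c0 by simp_all
  have compare: "\<exists>\<kappa>. \<forall>b. b \<subseteq> D - {i,j} \<longrightarrow> card b = 2 \<longrightarrow> c i b - c j b = \<kappa> * cone_primitive v b"
    if c: "\<And>i x. i \<in> I \<Longrightarrow> x \<noteq> v \<Longrightarrow> c i {v,x} = 0"
      "\<And>i t. i \<in> I \<Longrightarrow> t \<subseteq> D - {i} \<Longrightarrow> card t = 4 \<Longrightarrow> z t = cochain_color (c i) t"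
      and ij: "i \<in> I" "j \<in> I" for c i j
  proof (cases "i = j")
    case True
    then show ?thesis by (intro exI[of _ 0]) simp
  next
    case False
    let ?t = "D - {i,j}" and ?d = "\<lambda>b. c i b - 1 * c j b"
    have "?t \<subseteq> D - {i}" "?t \<subseteq> D - {j}" by auto
    then have "cochain_color (c i) ?t = cochain_color (c j) ?t"
      using c(2)[OF ij(1) _ c4[OF ij False]] c(2)[OF ij(2) _ c4[OF ij False]] by simp
    then have "cochain_color ?d ?t = 0"
      unfolding cochain_color_diff by (simp add: cscale_def)
    moreover have "v \<in> ?t" using v ij by auto
    moreover have "?d {v,x} = 0" if "x \<in> ?t - {v}" for x using c(1) ij that by simp
    ultimately obtain \<kappa> where "\<And>b. b \<subseteq> ?t \<Longrightarrow> card b = 2 \<Longrightarrow> ?d b = \<kappa> * cone_primitive v b"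
      using tetrahedron_kernel_gauged[OF c4[OF ij False], of v ?d] by blast
    then show ?thesis by (intro exI[of _ \<kappa>]) simp
  qed
  have "\<exists>\<kappa>. \<forall>b. b \<subseteq> D - {i,i0} \<longrightarrow> card b = 2 \<longrightarrow> c0 i b - c0 i0 b = \<kappa> * cone_primitive v b"
    if "i \<in> I" for i
    by (rule compare[OF c0g c0z that i0])
  then obtain \<kappa> where \<kappa>: "\<forall>i\<in>I. \<forall>b. b \<subseteq> D - {i,i0} \<longrightarrow> card b = 2 \<longrightarrow> c0 i b - c0 i0 b = \<kappa> i * cone_primitive v b"
    by metis
  \<comment> \<open>Adding multiples of the cone primitive makes all cochains agree with the one for \<open>i0\<close>.\<close>
  define c1 where "c1 = (\<lambda>i b. c0 i b - \<kappa> i * cone_primitive v b)"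
  have c1g: "c1 i {v,x} = 0" if "i \<in> I" "x \<noteq> v" for i x
    using c0g that by (simp add: c1_def cone_primitive_edge side_simps)
  have c1z: "z t = cochain_color (c1 i) t" if "i \<in> I" "t \<subseteq> D - {i}" "card t = 4" for i t
    using c0z[OF that] that(3)
    unfolding c1_def cochain_color_diff by (simp add: cochain_color_cone_primitive cscale_def zero_prod_def)
  have base: "c1 i b = c0 i0 b" if "i \<in> I" "b \<subseteq> D - {i,i0}" "card b = 2" for i b
    using \<kappa> that by (simp add: c1_def algebra_simps)
  have agree: "c1 i b = c1 j b" if ij: "i \<in> I" "j \<in> I" and b: "b \<subseteq> D - {i,j}" "card b = 2" for i j b
  proof (cases "i = j \<or> i = i0 \<or> j = i0")
    case True
    have "c1 k b = c0 i0 b" if "k \<in> I" "i0 \<notin> b" "k \<notin> b" for k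
      using base[of k b] b that by auto
    moreover have "i \<notin> b" "j \<notin> b" using b by auto
    ultimately show ?thesis using True ij by metis
  next
    case False
    \<comment> \<open>The edge \<open>?e\<close> lies in all three pentachora and avoids \<open>v\<close>; both cochains equal that of \<open>i0\<close> on it,
      which forces the multiple by which they differ to be zero.\<close>
    let ?e = "D - {i,j,i0,v}"
    have "\<exists>\<mu>. \<forall>b. b \<subseteq> D - {i,j} \<longrightarrow> card b = 2 \<longrightarrow> c1 i b - c1 j b = \<mu> * cone_primitive v b"
      by (rule compare[OF c1g c1z ij])
    then obtain \<mu> where "\<forall>b. b \<subseteq> D - {i,j} \<longrightarrow> card b = 2 \<longrightarrow> c1 i b - c1 j b = \<mu> * cone_primitive v b" ..
    then have l: "\<And>b. b \<subseteq> D - {i,j} \<Longrightarrow> card b = 2 \<Longrightarrow> c1 i b - c1 j b = \<mu> * cone_primitive v b" by simp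
    have "i \<noteq> v" "j \<noteq> v" "i0 \<noteq> v" using ij i0 v by metis+
    then have "card {i,j,i0,v} = 4" using False by simp
    moreover have "{i,j,i0,v} \<subseteq> D" using ij i0 v I by auto
    ultimately have "card ?e = 2" using D fin by (simp add: card_Diff_subset)
    then obtain x y where xy: "?e = {x,y}" "x \<noteq> y" by (auto simp: card_2_iff)
    have "v \<notin> ?e" by simp
    then have "x \<noteq> v" "y \<noteq> v" unfolding xy by auto
    then have nz: "cone_primitive v ?e \<noteq> (0::'f)" unfolding xy(1) cone_primitive_edge[OF xy(2)] by (simp add: side_def)
    have "?e \<subseteq> D - {i,i0}" "?e \<subseteq> D - {j,i0}" "?e \<subseteq> D - {i,j}" by auto
    then have "c1 i ?e = c1 j ?e" "c1 i ?e - c1 j ?e = \<mu> * cone_primitive v ?e"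
      using base[of i ?e] base[of j ?e] l[of ?e] ij \<open>card ?e = 2\<close> by simp_all
    then have "\<mu> = 0" using nz by simp
    then show ?thesis using l[OF b] by simp
  qed
  \<comment> \<open>Any pentachoron containing the edge gives the same value; edges outside the side get an arbitrary one.\<close>
  define c where "c = (\<lambda>b. c1 (SOME i. i \<in> I \<and> i \<notin> b) b)"
  have "z t = cochain_color c t" if t: "t \<in> tetrahedra (pachner_side D I)" for t
  proof -
    have "t \<subseteq> D" "card t = 4" "\<not> I \<subseteq> t" using t by (auto simp: tetrahedra_def pachner_side_def)
    then obtain i where i: "i \<in> I" "t \<subseteq> D - {i}" by auto
    have "cochain_color c t = cochain_color (c1 i) t"
    proof (rule cochain_color_cong[OF \<open>card t = 4\<close>])
      fix b assume b: "b \<subseteq> t" "card b = 2"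
      let ?j = "SOME i. i \<in> I \<and> i \<notin> b"
      have "?j \<in> I \<and> ?j \<notin> b" by (rule someI[of _ i]) (use i b in auto)
      then show "c b = c1 i b" unfolding c_def by (intro agree) (use b i in auto)
    qed
    then show ?thesis using c1z i \<open>card t = 4\<close> by simp
  qed
  moreover have "z t = 0" if "t \<notin> tetrahedra (pachner_side D I)" for t
    using z that by (simp add: permitted_def colorings_def)
  ultimately have "z = restr (pachner_side D I) (cochain_color c)"
    unfolding restr_def by (intro ext) simp
  then show ?thesis by (rule that)
qed

text \<open>
  The right-hand side does not mention \<open>I\<close>.  Applied to the common boundary of the two sides,
  this shows that their permitted colorings leave the same trace on it.
\<close>

lemma restr_boundary_permitted_side:
  fixes D I :: "'v::linorder set"
  assumes D: "card D = 6" and I: "I \<subseteq> D" "I \<noteq> {}" "I \<noteq> D"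
    and B: "B \<subseteq> pachner_side D I"
  shows "(restr B ` permitted (pachner_side D I) :: ('v, 'f::field) coloring set)
    = range (\<lambda>c. restr B (cochain_color c))"
proof -
  let ?K = "pachner_side D I"
  have "finite D" using D card.infinite by fastforce
  then have K: "abstract_complex ?K" by (rule abstract_pachner_side)
  have rr: "restr B (restr ?K z) = restr B z" for z :: "('v, 'f) coloring"
    unfolding restr_def by (rule ext) (use B in \<open>auto simp: tetrahedra_def\<close>)
  show ?thesis
  proof
    show "(restr B ` permitted ?K :: ('v, 'f) coloring set) \<subseteq> range (\<lambda>c. restr B (cochain_color c))"
    proof
      fix y :: "('v, 'f) coloring" assume "y \<in> restr B ` permitted ?K"
      then obtain z where z: "z \<in> permitted ?K" "y = restr B z" by blast
      obtain c where "z = restr ?K (cochain_color c)" using D I z(1) by (rule permitted_side_cochain_color)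
      then show "y \<in> range (\<lambda>c. restr B (cochain_color c))" using z(2) rr by simp
    qed
    show "range (\<lambda>c. restr B (cochain_color c)) \<subseteq> (restr B ` permitted ?K :: ('v, 'f) coloring set)"
    proof
      fix y :: "('v, 'f) coloring" assume "y \<in> range (\<lambda>c. restr B (cochain_color c))"
      then obtain c where "y = restr B (cochain_color c)" by blast
      then have "y = restr B (restr ?K (cochain_color c))" by (simp only: rr)
      then show "y \<in> restr B ` permitted ?K" using permitted_restr_cochain_color[OF K] by blast
    qed
  qed
qed


section \<open>Permitted colorings vanishing on the boundary\<close>

text \<open>
  The tetrahedra \<open>D - {i,j}\<close> with \<open>i \<in> A - {v}\<close> and \<open>j \<notin> A\<close> contain \<open>v\<close> and form a
  rectangular grid; they are boundary tetrahedra of the side formed by the pentachora opposite to \<open>A\<close>.  On each of them the cochain is a multiple of the cone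
  primitive.  Any two in the same row or column share an edge away from \<open>v\<close>, so the multiple is the same throughout.
  The exceptional edges of the conclusion are those contained in none of these tetrahedra.
  The lemma is used with either side as \<open>A\<close>.
\<close>

lemma grid_gauge:
  fixes c :: "'v::linorder set \<Rightarrow> 'f::field"
  assumes D: "card D = 6" and A: "A \<subseteq> D" "v \<in> A"
    and gauge: "\<And>x. x \<noteq> v \<Longrightarrow> c {v,x} = 0"
    and zero: "\<And>i j. i \<in> A \<Longrightarrow> i \<noteq> v \<Longrightarrow> j \<in> D - A \<Longrightarrow> cochain_color c (D - {i,j}) = 0"
  obtains \<kappa> where "\<And>b. b \<subseteq> D \<Longrightarrow> card b = 2 \<Longrightarrow> \<not> A - {v} \<subseteq> b \<Longrightarrow> \<not> D - A \<subseteq> b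
    \<Longrightarrow> c b = \<kappa> * cone_primitive v b"
proof -
  have fin: "finite D" using D card.infinite by fastforce
  have cell: "\<exists>\<kappa>. \<forall>b. b \<subseteq> D - {i,j} \<longrightarrow> card b = 2 \<longrightarrow> c b = \<kappa> * cone_primitive v b"
    if ij: "i \<in> A" "i \<noteq> v" "j \<in> D - A" for i j
  proof -
    have "i \<noteq> j" "{i,j} \<subseteq> D" using ij A by auto
    then have t: "card (D - {i,j}) = 4" using D fin by (simp add: card_Diff_subset)
    have "v \<in> D - {i,j}" using ij A by auto
    then obtain \<kappa> where "\<And>b. b \<subseteq> D - {i,j} \<Longrightarrow> card b = 2 \<Longrightarrow> c b = \<kappa> * cone_primitive v b"
      using tetrahedron_kernel_gauged[of "D - {i,j}" v c] t gauge zero[OF ij] by auto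
    then show ?thesis by blast
  qed
  define \<kappa> where "\<kappa> i j = (SOME \<kappa>. \<forall>b. b \<subseteq> D - {i,j} \<longrightarrow> card b = 2 \<longrightarrow> c b = \<kappa> * cone_primitive v b)" for i j
  have \<kappa>: "c b = \<kappa> i j * cone_primitive v b"
    if "i \<in> A" "i \<noteq> v" "j \<in> D - A" "b \<subseteq> D - {i,j}" "card b = 2" for i j b
    using someI_ex[OF cell[OF that(1-3)]] that(4,5) unfolding \<kappa>_def by blast
  \<comment> \<open>At most four vertices are removed, so the two tetrahedra share an edge that avoids \<open>v\<close>.\<close>
  have eq: "\<kappa> i j = \<kappa> i' j'" if ij: "i \<in> A" "i \<noteq> v" "j \<in> D - A" and ij': "i' \<in> A" "i' \<noteq> v" "j' \<in> D - A"
    and S: "card {i,j,i',j',v} \<le> 4" for i j i' j'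
  proof -
    have "2 \<le> card (D - {i,j,i',j',v})"
      using diff_card_le_card_Diff[of "{i,j,i',j',v}" D] S D by simp
    then obtain b where b: "b \<subseteq> D - {i,j,i',j',v}" "card b = 2"
      by (meson obtain_subset_with_card_n)
    then obtain x y where xy: "b = {x,y}" "x \<noteq> y" by (auto simp: card_2_iff)
    then have "x \<noteq> v" "y \<noteq> v" using b by auto
    then have nz: "cone_primitive v b \<noteq> (0::'f)" unfolding xy(1) cone_primitive_edge[OF xy(2)] by (simp add: side_def)
    have "b \<subseteq> D - {i,j}" "b \<subseteq> D - {i',j'}" using b by auto
    then have "\<kappa> i j * cone_primitive v b = \<kappa> i' j' * cone_primitive v b"
      using \<kappa>[OF ij _ b(2)] \<kappa>[OF ij' _ b(2)] by metis
    then show ?thesis using nz by simp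
  qed
  have row: "\<kappa> i j = \<kappa> i' j" if "i \<in> A" "i \<noteq> v" "i' \<in> A" "i' \<noteq> v" "j \<in> D - A" for i i' j
  proof (rule eq)
    have "{i,j,i',j,v} = {i,j,i',v}" by auto
    then show "card {i,j,i',j,v} \<le> 4" by (simp add: card_insert_if)
  qed (use that in auto)
  have column: "\<kappa> i j = \<kappa> i j'" if "i \<in> A" "i \<noteq> v" "j \<in> D - A" "j' \<in> D - A" for i j j'
  proof (rule eq)
    have "{i,j,i,j',v} = {i,j,j',v}" by auto
    then show "card {i,j,i,j',v} \<le> 4" by (simp add: card_insert_if)
  qed (use that in auto)
  show ?thesis
  proof (cases "\<exists>i j. i \<in> A \<and> i \<noteq> v \<and> j \<in> D - A")
    case True
    then obtain i0 j0 where 0: "i0 \<in> A" "i0 \<noteq> v" "j0 \<in> D - A" by blast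
    show ?thesis
    proof (rule that)
      fix b assume b: "b \<subseteq> D" "card b = 2" "\<not> A - {v} \<subseteq> b" "\<not> D - A \<subseteq> b"
      then obtain i j where ij: "i \<in> A" "i \<noteq> v" "i \<notin> b" "j \<in> D - A" "j \<notin> b" by blast
      then have "b \<subseteq> D - {i,j}" using b by auto
      then have "c b = \<kappa> i j * cone_primitive v b" using \<kappa> ij b by blast
      then show "c b = \<kappa> i0 j0 * cone_primitive v b"
        using row[OF ij(1,2) 0(1,2) ij(4)] column[OF 0(1,2) ij(4) 0(3)] by simp
    qed
  next
    case False
    show ?thesis by (rule that[of 0]) (use False in blast)
  qed
qed

text \<open>
  By \<open>grid_gauge\<close>, a coloring that vanishes on the boundary comes from a cochain supported on exceptional
  edges.  With \<open>A = I\<close> these are exactly the inner edges, provided that \<open>I\<close> has at least four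
  elements, for then no edge contains \<open>I - {v}\<close>.  For smaller \<open>I\<close> one takes the complement of \<open>I\<close> as \<open>A\<close>;
  the only possible exceptional edge of this side is then \<open>D - I - {v}\<close>, and it is seen by a boundary tetrahedron.
\<close>

lemma permitted_rel_side:
  fixes D I :: "'v::linorder set"
  assumes D: "card D = 6" and I: "I \<subseteq> D" "I \<noteq> {}" "I \<noteq> D"
  shows "(permitted_rel (pachner_side D I) :: ('v, 'f::field) coloring set)
    = col.span (edge_vector (pachner_side D I) ` inner_edges (pachner_side D I))"
proof -
  let ?K = "pachner_side D I"
  have fin: "finite D" using D card.infinite by fastforce
  have finI: "finite I" using fin I by (meson finite_subset)
  have K: "abstract_complex ?K" by (rule abstract_pachner_side[OF fin])
  have sub: "inner_edges ?K \<subseteq> edges ?K" by (auto simp: inner_edges_def)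
  have "\<exists>d. z = restr ?K (cochain_color d) \<and> (\<forall>b\<in>edges ?K - inner_edges ?K. d b = 0)"
    if z: "z \<in> permitted_rel ?K" for z :: "('v, 'f) coloring"
  proof -
    obtain c0 where c0: "z = restr ?K (cochain_color c0)"
      using permitted_side_cochain_color[OF D I] z by (auto simp: permitted_rel_def)
    \<comment> \<open>Every cochain \<open>c\<close> with the same colors as \<open>c0\<close> has zero color on the boundary.\<close>
    have bd: "cochain_color c t = 0"
      if t: "t \<subseteq> D" "card t = 4" "\<not> I \<subseteq> t" "\<not> D - I \<subseteq> t"
        and c: "\<And>t. card t = 4 \<Longrightarrow> cochain_color c t = cochain_color c0 t" for c t
    proof -
      have "z t = 0" using z t by (auto simp: permitted_rel_def tetrahedra_boundary_pachner_side[OF D I(1)])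
      moreover have "z t = cochain_color c0 t" using t by (simp add: c0 restr_def tetrahedra_pachner_side)
      ultimately show ?thesis using c t(2) by simp
    qed
    have restrI: "z = restr ?K (cochain_color d)"
      if "\<And>t. card t = 4 \<Longrightarrow> cochain_color d t = cochain_color c0 t" for d
      unfolding c0 restr_def by (rule ext) (simp add: that tetrahedra_def)
    have shift: "cochain_color (\<lambda>b. c b - \<kappa> * cone_primitive v b) t = cochain_color c0 t"
      if "card t = 4" "cochain_color c t = cochain_color c0 t" for c \<kappa> v t
      unfolding cochain_color_diff
      by (simp add: that cochain_color_cone_primitive[OF that(1)] cscale_def zero_prod_def)
    show ?thesis
    proof (cases "card I \<le> 3")
      case True
      obtain v where v: "v \<in> D" "v \<notin> I" using I by auto
      obtain i where i: "i \<in> I" using I by auto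
      obtain c where gauge: "\<And>x. x \<noteq> v \<Longrightarrow> c {v,x} = 0"
        and c: "\<And>t. card t = 4 \<Longrightarrow> cochain_color c t = cochain_color c0 t"
        by (rule gauge_fix[of v c0]) blast
      have DDI: "D - (D - I) = I" using I by auto
      obtain \<kappa> where \<kappa>: "\<And>b. b \<subseteq> D \<Longrightarrow> card b = 2 \<Longrightarrow> \<not> D - I - {v} \<subseteq> b \<Longrightarrow> \<not> I \<subseteq> b
          \<Longrightarrow> c b = \<kappa> * cone_primitive v b"
      proof (rule grid_gauge[of D "D - I" v c])
        fix p q assume p: "p \<in> D - I" "p \<noteq> v" "q \<in> D - (D - I)"
        then show "cochain_color c (D - {p,q}) = 0"
          by (intro bd c six_minus_two D) (use I v in auto)
      qed (use D v gauge DDI in auto)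
      define d where "d = (\<lambda>b. c b - \<kappa> * cone_primitive v b)"
      have d: "cochain_color d t = cochain_color c0 t" if "card t = 4" for t
        unfolding d_def using shift that c by blast
      have dz: "d b = 0" if "b \<subseteq> D" "card b = 2" "\<not> D - I - {v} \<subseteq> b" "\<not> I \<subseteq> b" for b
        using \<kappa>[OF that] by (simp add: d_def)
      have cJ: "2 \<le> card (D - I - {v})"
        using True D v fin finI I by (simp add: card_Diff_subset)
      \<comment> \<open>The boundary tetrahedron \<open>D - {i,v}\<close> contains the exceptional edge, and no other edge of it carries a value of \<open>d\<close>.\<close>
      have last: "d b = 0" if b: "b \<subseteq> D" "card b = 2" "D - I - {v} \<subseteq> b" for b
      proof -
        have "finite b" using b(1) fin finite_subset by blast
        then have beq: "b = D - I - {v}" using card_seteq[OF _ b(3)] b(2) cJ by simp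
        have t4: "card (D - {i,v}) = 4" by (rule six_minus_two[OF D]) (use i v I in auto)
        show ?thesis
        proof (rule cochain_color_single_edge[OF t4])
          show "b \<subseteq> D - {i,v}" using beq i by auto
          show "cochain_color d (D - {i,v}) = 0" using t4 i v by (intro bd d) auto
          fix b' assume b': "b' \<subseteq> D - {i,v}" "card b' = 2" "b' \<noteq> b"
          have "\<not> b \<subseteq> b'" using card_seteq[of b' b] b' b(2) fin finite_subset[of b' D] by auto
          then show "d b' = 0" using b' i by (intro dz) (auto simp: beq)
        qed (rule b(2))
      qed
      have "d b = 0" if "b \<in> edges ?K" for b
        using that dz[of b] last[of b] by (auto simp: edges_pachner_side)
      then show ?thesis using restrI[of d] d by blast
    next
      case False
      obtain v where v: "v \<in> I" using I by auto
      obtain c where gauge: "\<And>x. x \<noteq> v \<Longrightarrow> c {v,x} = 0"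
        and c: "\<And>t. card t = 4 \<Longrightarrow> cochain_color c t = cochain_color c0 t"
        by (rule gauge_fix[of v c0]) blast
      obtain \<kappa> where \<kappa>: "\<And>b. b \<subseteq> D \<Longrightarrow> card b = 2 \<Longrightarrow> \<not> I - {v} \<subseteq> b \<Longrightarrow> \<not> D - I \<subseteq> b
          \<Longrightarrow> c b = \<kappa> * cone_primitive v b"
      proof (rule grid_gauge[of D I v c])
        fix p q assume p: "p \<in> I" "p \<noteq> v" "q \<in> D - I"
        then show "cochain_color c (D - {p,q}) = 0"
          by (intro bd c six_minus_two D) (use I v in auto)
      qed (use D I v gauge in auto)
      define d where "d = (\<lambda>b. c b - \<kappa> * cone_primitive v b)"
      have d: "cochain_color d t = cochain_color c0 t" if "card t = 4" for t
        unfolding d_def using shift that c by blast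
      have "d b = 0" if b: "b \<in> edges ?K - inner_edges ?K" for b
      proof -
        have b': "b \<subseteq> D" "card b = 2" "\<not> D - I \<subseteq> b"
          using b by (auto simp: edges_pachner_side inner_edges_pachner_side[OF D I(1)])
        have "\<not> I - {v} \<subseteq> b"
          using card_mono[of b "I - {v}"] b' fin finite_subset[of b D] False v finI by auto
        then show ?thesis using \<kappa>[of b] b' by (simp add: d_def)
      qed
      then show ?thesis using restrI[of d] d by blast
    qed
  qed
  then show ?thesis
    unfolding span_edge_vectors[OF K sub] using restr_inner_edges_mem_permitted_rel[OF K] by auto
qed

text \<open>
  Inner edges contain \<open>D - I\<close>, which has \<open>6 - k\<close> elements: too many for \<open>k \<le> 3\<close>, exactly an edge for \<open>k = 4\<close>.
  For \<open>k = 5\<close> the inner edges are the five edges at a vertex \<open>v\<close>.  The coboundary of \<open>v\<close> expresses one of their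
  vectors by the other four, and the four are independent by \<open>tetrahedron_kernel_gauged\<close>
  applied in the gauge at the end \<open>x0\<close> of the omitted edge.
\<close>

lemma dim_permitted_rel_side:
  fixes D I :: "'v::linorder set"
  assumes D: "card D = 6" and I: "I \<subseteq> D" "I \<noteq> {}" "I \<noteq> D"
  shows "col.dim (permitted_rel (pachner_side D I) :: ('v, 'f::field) coloring set) = pachner_dim (card I)"
proof -
  let ?K = "pachner_side D I"
  have fin: "finite D" using D card.infinite by fastforce
  have finI: "finite I" using fin I by (meson finite_subset)
  have K: "abstract_complex ?K" by (rule abstract_pachner_side[OF fin])
  have "card I < 6" using psubset_card_mono[OF fin, of I] I D by auto
  have cJ: "card (D - I) = 6 - card I" using D I finI by (simp add: card_Diff_subset)
  note inner = inner_edges_pachner_side[OF D I(1)]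
  have sub: "inner_edges ?K \<subseteq> edges ?K" by (auto simp: inner_edges_def)
  have vanishes: "cochain_color c t = 0"
    if "restr ?K (cochain_color c) = 0" "t \<subseteq> D" "card t = 4" "\<not> I \<subseteq> t" for c :: "'v set \<Rightarrow> 'f" and t
    using fun_cong[OF that(1), of t] that by (simp add: restr_def tetrahedra_pachner_side)
  consider "card I \<le> 3" | "card I = 4" | "card I = 5" using \<open>card I < 6\<close> by linarith
  then show ?thesis
  proof cases
    case 1
    have "\<not> D - I \<subseteq> b" if "b \<subseteq> D" "card b = 2" for b
      using card_mono[of b "D - I"] that cJ 1 fin finite_subset[of b D] by auto
    then have "inner_edges ?K = {}" unfolding inner by auto
    then show ?thesis using 1 dim_span_edge_vectors[OF K, of "{}", where 'f = 'f]
      unfolding permitted_rel_side[OF D I] by (simp add: pachner_dim_def)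
  next
    case 2
    let ?J = "D - I"
    have "b = ?J" if "b \<subseteq> D" "card b = 2" "?J \<subseteq> b" for b
      using card_seteq[OF _ that(3)] that cJ 2 fin finite_subset[of b D] by simp
    moreover have "\<not> I \<subseteq> ?J" using I by auto
    ultimately have E: "inner_edges ?K = {?J}" unfolding inner using cJ 2 by auto
    \<comment> \<open>The tetrahedron \<open>D - {i,j}\<close> contains the only inner edge and detects its coefficient.\<close>
    obtain i j where ij: "i \<in> I" "j \<in> I" "i \<noteq> j"
      using 2 by (metis card_le_Suc0_iff_eq[OF finI] numeral_le_one_iff One_nat_def semiring_norm(69))
    have t4: "card (D - {i,j}) = 4" by (rule six_minus_two[OF D]) (use ij I in auto)
    have "col.dim (col.span (edge_vector ?K ` {?J}) :: ('v, 'f) coloring set) = card {?J}"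
    proof (rule dim_span_edge_vectors[OF K])
      fix c :: "'v set \<Rightarrow> 'f" and b
      assume c: "\<And>b. b \<in> edges ?K - {?J} \<Longrightarrow> c b = 0" "restr ?K (cochain_color c) = 0" and b: "b \<in> {?J}"
      show "c b = 0"
      proof (rule cochain_color_single_edge[OF t4])
        show "b \<subseteq> D - {i,j}" "card b = 2" using b ij cJ 2 by auto
        show "cochain_color c (D - {i,j}) = 0" by (rule vanishes[OF c(2) _ t4]) (use ij in auto)
        fix b' assume "b' \<subseteq> D - {i,j}" "card b' = 2" "b' \<noteq> b"
        then show "c b' = 0" using ij b by (intro c(1)) (auto simp: edges_pachner_side)
      qed
    qed (use E sub in auto)
    then show ?thesis using 2 unfolding permitted_rel_side[OF D I] E by (simp add: pachner_dim_def)
  next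
    case 3
    then have "card (D - I) = 1" using cJ by simp
    then obtain v where v: "D - I = {v}" by (auto simp: card_1_singleton_iff)
    then have vI: "v \<in> D" "v \<notin> I" "D = insert v I" using I by auto
    obtain x0 where x0: "x0 \<in> I" using I by auto
    let ?E = "(\<lambda>x. {v,x}) ` (I - {x0})"
    have notI: "\<not> I \<subseteq> b" if "card b < 5" "b \<subseteq> D" for b
      using card_mono[of b I] 3 that fin finite_subset[of b D] by auto
    have inner': "inner_edges ?K = (\<lambda>x. {v,x}) ` I"
    proof
      show "inner_edges ?K \<subseteq> (\<lambda>x. {v,x}) ` I"
      proof
        fix b assume "b \<in> inner_edges ?K"
        then have b: "b \<subseteq> D" "card b = 2" "v \<in> b" unfolding inner v by auto
        then obtain x where "b = {v,x}" "x \<noteq> v" by (auto simp: card_2_iff)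
        then show "b \<in> (\<lambda>x. {v,x}) ` I" using b vI by auto
      qed
      show "(\<lambda>x. {v,x}) ` I \<subseteq> inner_edges ?K"
      proof
        fix b assume "b \<in> (\<lambda>x. {v,x}) ` I"
        then obtain x where x: "x \<in> I" "b = {v,x}" by auto
        then have "x \<noteq> v" using vI by auto
        then have "b \<subseteq> D" "card b = 2" "v \<in> b" using x vI by auto
        then show "b \<in> inner_edges ?K" using notI[of b] unfolding inner v by auto
      qed
    qed
    have "col.span (edge_vector ?K ` inner_edges ?K) = (col.span (edge_vector ?K ` ?E) :: ('v, 'f) coloring set)"
    proof
      show "(col.span (edge_vector ?K ` ?E) :: ('v, 'f) coloring set) \<subseteq> col.span (edge_vector ?K ` inner_edges ?K)"
        unfolding inner' by (intro col.span_mono) auto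
      show "col.span (edge_vector ?K ` inner_edges ?K) \<subseteq> (col.span (edge_vector ?K ` ?E) :: ('v, 'f) coloring set)"
      proof
        fix z :: "('v, 'f) coloring" assume "z \<in> col.span (edge_vector ?K ` inner_edges ?K)"
        then obtain c where z: "z = restr ?K (cochain_color c)" and c: "\<And>b. b \<in> edges ?K - inner_edges ?K \<Longrightarrow> c b = 0"
          unfolding span_edge_vectors[OF K sub] by blast
        \<comment> \<open>The coboundary of the vertex \<open>v\<close> is \<open>1\<close> or \<open>- 1\<close> on each edge at \<open>v\<close> and zero elsewhere; a multiple of it
          removes the coefficient of \<open>{v,x0}\<close> without changing the colors.\<close>
        let ?g = "coboundary (\<lambda>x. if x = v then 1 else 0) :: 'v set \<Rightarrow> 'f"
        define d where "d = (\<lambda>b. c b - c {v,x0} * ?g {v,x0} * ?g b)"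
        have "x0 \<noteq> v" using x0 vI by auto
        then have g: "?g {v,x0} * ?g {v,x0} = 1"
          using coboundary_ordered[of v x0 "\<lambda>x. if x = v then 1 else 0 :: 'f"]
            coboundary_ordered[of x0 v "\<lambda>x. if x = v then 1 else 0 :: 'f"]
          by (cases "v < x0") (auto simp: insert_commute)
        have "cochain_color d t = cochain_color c t" if "card t = 4" for t
          unfolding d_def cochain_color_diff
          by (simp add: cochain_color_coboundary[OF that] cscale_def zero_prod_def)
        then have "z = restr ?K (cochain_color d)"
          unfolding z restr_def by (intro ext) (simp add: tetrahedra_def)
        moreover have "d b = 0" if b: "b \<in> edges ?K - ?E" for b
        proof (cases "b = {v,x0}")
          case True
          then show ?thesis using g by (simp add: d_def mult.assoc)
        next
          case False
          then have nb: "b \<notin> inner_edges ?K" using b unfolding inner' by auto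
          then have "c b = 0" using b c by blast
          moreover have "v \<notin> b"
            using b nb notI[of b] unfolding inner v by (auto simp: edges_pachner_side)
          moreover have "finite b" "b \<noteq> {}" using b by (auto simp: edges_def intro: card_ge_0_finite)
          then have "Min b \<in> b" "Max b \<in> b" by auto
          ultimately show ?thesis by (auto simp: d_def coboundary_def)
        qed
        ultimately show "z \<in> col.span (edge_vector ?K ` ?E)"
          using sub unfolding inner' by (subst span_edge_vectors[OF K]) auto
      qed
    qed
    moreover have "col.dim (col.span (edge_vector ?K ` ?E) :: ('v, 'f) coloring set) = card ?E"
    proof (rule dim_span_edge_vectors[OF K])
      show "?E \<subseteq> edges ?K" using sub unfolding inner' by auto
      fix c :: "'v set \<Rightarrow> 'f" and b
      assume c: "\<And>b. b \<in> edges ?K - ?E \<Longrightarrow> c b = 0" "restr ?K (cochain_color c) = 0" and b: "b \<in> ?E"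
      obtain x where x: "x \<in> I" "x \<noteq> x0" "b = {v,x}" using b by auto
      have "card (I - {x0,x}) = 3" using 3 finI x x0 by (simp add: card_Diff_subset)
      then obtain y where y: "y \<in> I" "y \<noteq> x0" "y \<noteq> x" by (metis DiffE all_not_in_conv card.empty insertCI zero_neq_numeral)
      let ?t = "{v,x0,x,y}"
      have ne: "v \<noteq> x0" "v \<noteq> x" "v \<noteq> y" using vI x0 x y by auto
      have t: "card ?t = 4" "?t \<subseteq> D" using ne x y x0 vI by auto
      have ed: "s \<in> edges ?K" if "s \<subseteq> ?t" "card s = 2" for s
        using that t notI[of s] by (auto simp: edges_pachner_side)
      have E: "v \<in> s" "x0 \<notin> s" if "s \<in> ?E" for s using that ne(1) by auto
      have "c {x0,w} = 0" if w: "w \<in> ?t - {x0}" for w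
      proof (rule c(1))
        have "{x0,w} \<subseteq> ?t" "card {x0,w} = 2" using w by auto
        then show "{x0,w} \<in> edges ?K - ?E" using ed E(2)[of "{x0,w}"] by blast
      qed
      moreover have "\<not> I \<subseteq> ?t" by (rule notI) (use t in auto)
      then have "cochain_color c ?t = 0" by (rule vanishes[OF c(2) t(2,1)])
      ultimately obtain \<kappa> where \<kappa>: "\<And>b. b \<subseteq> ?t \<Longrightarrow> card b = 2 \<Longrightarrow> c b = \<kappa> * cone_primitive x0 b"
        using tetrahedron_kernel_gauged[OF t(1), of x0 c] by auto
      have "c {x,y} = 0"
      proof (rule c(1))
        have "{x,y} \<subseteq> ?t" "card {x,y} = 2" "v \<notin> {x,y}" using y ne by auto
        then show "{x,y} \<in> edges ?K - ?E" using ed E(1)[of "{x,y}"] by blast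
      qed
      then have "\<kappa> * cone_primitive x0 {x,y} = 0" using \<kappa>[of "{x,y}"] y by simp
      then have "\<kappa> = 0" using x y by (simp add: cone_primitive_edge side_def split: if_splits)
      then show "c b = 0" using \<kappa>[of b] x ne by simp
    qed
    moreover have "card ?E = 4"
    proof -
      have "inj_on (\<lambda>x. {v,x}) (I - {x0})" using vI by (auto simp: inj_on_def doubleton_eq_iff)
      then show ?thesis using 3 x0 finI by (simp add: card_image)
    qed
    ultimately show ?thesis using 3 unfolding permitted_rel_side[OF D I] by (simp add: pachner_dim_def)
  qed
qed


section \<open>Replacing one side by the other in a larger complex\<close>

lemma restr_permitted:
  assumes "abstract_complex L" "L \<subseteq> K" "z \<in> permitted K"
  shows "restr L z \<in> permitted L"
proof -
  have "edge_functional u b (restr L z) = 0" if u: "u \<in> pentachora L" and b: "b \<subseteq> u" "card b = 2" for u b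
  proof -
    have u': "u \<in> L" "card u = 5" using u by (auto simp: pentachora_def)
    have "edge_functional u b (restr L z) = edge_functional u b z"
      by (rule edge_functional_cong[OF u'(2)]) (simp add: restr_def tetrahedra_faceI[OF assms(1) u'(1)])
    moreover have "u \<in> pentachora K" using u' assms(2) by (auto simp: pentachora_def)
    ultimately show ?thesis using assms(3) b by (simp add: permitted_def)
  qed
  then show ?thesis by (simp add: permitted_def colorings_def restr_def)
qed

text \<open>
  The coloring is kept on \<open>R\<close> and its boundary values are extended over \<open>C'\<close>.  Since \<open>R\<close> and \<open>C'\<close> meet in \<open>B\<close> only,
  each pentachoron lies in one of the two parts and sees one permitted coloring.
\<close>

lemma permitted_extends_across_replacement:
  fixes c :: "('v::linorder, 'f::field) coloring"
  assumes cx: "abstract_complex R" "abstract_complex C" "abstract_complex C'"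
    and B: "R \<inter> C = B" "R \<inter> C' = B"
    and same: "restr B ` permitted C \<subseteq> (restr B ` permitted C' :: ('v, 'f) coloring set)"
    and c: "c \<in> permitted (R \<union> C)"
  obtains c' where "c' \<in> permitted (R \<union> C')" "restr R c = restr R c'"
proof -
  have "restr C c \<in> permitted C" using restr_permitted[OF cx(2) _ c] by simp
  then have "restr B (restr C c) \<in> restr B ` permitted C'" using same by blast
  then obtain z where z: "z \<in> permitted C'" "restr B (restr C c) = restr B z" by blast
  have cB: "c t = z t" if "t \<in> tetrahedra R" "t \<in> tetrahedra C'" for t
  proof -
    have "t \<in> tetrahedra B" "t \<in> tetrahedra C" using that B by (auto simp: tetrahedra_def)
    then show ?thesis using fun_cong[OF z(2), of t] by (simp add: restr_def)
  qed
  define c' where "c' = (\<lambda>t. if t \<in> tetrahedra R then c t else z t)"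
  have "c' \<in> colorings (R \<union> C')"
    using z(1) by (simp add: colorings_def permitted_def c'_def tetrahedra_def)
  moreover have "edge_functional u b c' = 0"
    if u: "u \<in> pentachora (R \<union> C')" and b: "b \<subseteq> u" "card b = 2" for u b
  proof -
    have u5: "card u = 5" using u by (simp add: pentachora_def)
    consider "u \<in> R" | "u \<in> C'" using u by (auto simp: pentachora_def)
    then show ?thesis
    proof cases
      case 1
      have "edge_functional u b c' = edge_functional u b c"
        by (rule edge_functional_cong[OF u5]) (simp add: c'_def tetrahedra_faceI[OF cx(1) 1])
      moreover have "u \<in> pentachora (R \<union> C)" using 1 u5 by (simp add: pentachora_def)
      ultimately show ?thesis using c b by (simp add: permitted_def)
    next
      case 2
      have "edge_functional u b c' = edge_functional u b z"
        by (rule edge_functional_cong[OF u5]) (simp add: c'_def cB tetrahedra_faceI[OF cx(3) 2])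
      moreover have "u \<in> pentachora C'" using 2 u5 by (simp add: pentachora_def)
      ultimately show ?thesis using z b by (simp add: permitted_def)
    qed
  qed
  ultimately have "c' \<in> permitted (R \<union> C')" by (simp add: permitted_def)
  moreover have "restr R c = restr R c'" unfolding restr_def c'_def by (rule ext) simp
  ultimately show ?thesis by (rule that)
qed

lemma subspace_edge_generated: "col.subspace (edge_generated K)"
  by (simp add: edge_generated_def col.subspace_span)

lemma abstract_Un: "abstract_complex R \<Longrightarrow> abstract_complex C \<Longrightarrow> abstract_complex (R \<union> C)"
  unfolding abstract_complex_def ball_Un by (meson UnCI UnE finite_UnI)

text \<open>
  The coefficients of \<open>c\<close> define an edge-generated coloring of the new complex with
  the same restriction to \<open>R\<close>.  Its difference from \<open>c'\<close> is concentrated inside \<open>C'\<close>, hence generated by inner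
  edges of \<open>C'\<close>, whose edge vectors in \<open>C'\<close> and in the whole complex agree.
\<close>

lemma edge_generated_transfers_across_replacement:
  fixes c c' :: "('v::linorder, 'f::field) coloring"
  assumes cx: "abstract_complex R" "abstract_complex C" "abstract_complex C'"
    and B: "R \<inter> C' = boundary C'"
    and rel: "permitted_rel C' = (col.span (edge_vector C' ` inner_edges C') :: ('v, 'f) coloring set)"
    and c: "c \<in> edge_generated (R \<union> C)" and c': "c' \<in> permitted (R \<union> C')"
    and R: "restr R c = restr R c'"
  shows "c' \<in> edge_generated (R \<union> C')"
proof -
  let ?K = "R \<union> C" and ?K' = "R \<union> C'"
  have K: "abstract_complex ?K" and K': "abstract_complex ?K'" using cx by (auto intro: abstract_Un)
  obtain a where a: "c = restr ?K (cochain_color a)" using c unfolding edge_generated_eq[OF K] by blast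
  \<comment> \<open>The same cochain evaluated on the new complex: on \<open>R\<close> this agrees with \<open>c\<close>.\<close>
  define d where "d = restr ?K' (cochain_color a)"
  have d_eg: "d \<in> edge_generated ?K'" unfolding edge_generated_eq[OF K'] d_def by blast
  define z where "z = c' - d"
  have z: "z \<in> permitted ?K'"
    unfolding z_def d_def by (intro col.subspace_diff subspace_permitted c' permitted_restr_cochain_color K')
  have zR: "z t = 0" if t: "t \<in> tetrahedra R" for t
  proof -
    have "c t = c' t" using fun_cong[OF R, of t] t by (simp add: restr_def)
    moreover have "t \<in> tetrahedra ?K" "t \<in> tetrahedra ?K'" using t by (auto simp: tetrahedra_def)
    ultimately show ?thesis by (simp add: z_def d_def a restr_def)
  qed
  have "restr C' z \<in> permitted_rel C'"
  proof -
    have "restr C' z \<in> permitted C'" by (rule restr_permitted[OF cx(3) _ z]) simp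
    moreover have "restr C' z t = 0" if "t \<in> tetrahedra (boundary C')" for t
      using that zR[of t] unfolding B[symmetric] by (simp add: restr_def tetrahedra_def)
    ultimately show ?thesis by (simp add: permitted_rel_def)
  qed
  moreover have "inner_edges C' \<subseteq> edges C'" by (auto simp: inner_edges_def)
  ultimately obtain e where e: "restr C' z = restr C' (cochain_color e)"
    "\<forall>b\<in>edges C' - inner_edges C'. e b = 0"
    unfolding rel using span_edge_vectors[OF cx(3), of "inner_edges C'"] by blast
  define e' where "e' = (\<lambda>b. if b \<in> inner_edges C' then e b else 0)"
  have "z t = restr ?K' (cochain_color e') t" for t
  proof -
    consider "t \<in> tetrahedra C'" | "t \<in> tetrahedra R" | "t \<notin> tetrahedra ?K'" by (auto simp: tetrahedra_def)
    then show ?thesis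
    proof cases
      case 1
      then have t: "t \<in> C'" "card t = 4" by (auto simp: tetrahedra_def)
      have "cochain_color e' t = cochain_color e t"
        by (rule cochain_color_cong[OF t(2)])
          (use e(2) edges_faceI[OF cx(3) t(1)] in \<open>auto simp: e'_def\<close>)
      moreover have "z t = cochain_color e t" using fun_cong[OF e(1), of t] 1 by (simp add: restr_def)
      moreover have "t \<in> tetrahedra ?K'" using 1 by (auto simp: tetrahedra_def)
      ultimately show ?thesis by (simp add: restr_def)
    next
      case 2
      then have t: "t \<in> R" "card t = 4" by (auto simp: tetrahedra_def)
      have "cochain_color e' t = cochain_color (\<lambda>b. 0) t"
      proof (rule cochain_color_cong[OF t(2)])
        fix b assume "b \<subseteq> t" "card b = 2"
        then have "b \<in> R" using edges_faceI[OF cx(1) t(1)] by (auto simp: edges_def)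
        then show "e' b = 0" using B by (auto simp: e'_def inner_edges_def edges_def)
      qed
      then show ?thesis using zR[OF 2] by (simp add: restr_def cochain_color_zero)
    next
      case 3
      then show ?thesis using z by (simp add: permitted_def colorings_def restr_def)
    qed
  qed
  then have "z = restr ?K' (cochain_color e')" by (rule ext)
  then have "z \<in> edge_generated ?K'" unfolding edge_generated_eq[OF K'] by blast
  then have "d + z \<in> edge_generated ?K'" by (rule col.subspace_add[OF subspace_edge_generated d_eg])
  then show ?thesis by (simp add: z_def)
qed

lemma hclass_iff: "x \<in> hclass K c \<longleftrightarrow> x - c \<in> edge_generated K"
proof
  assume "x \<in> hclass K c"
  then obtain z where "x = c + z" "z \<in> edge_generated K" by (auto simp: hclass_def)
  then show "x - c \<in> edge_generated K" by (metis add_diff_cancel_left')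
next
  assume "x - c \<in> edge_generated K"
  then show "x \<in> hclass K c"
    unfolding hclass_def by (intro CollectI exI[of _ "x - c"] conjI) (metis add_diff_cancel_left' diff_add_cancel add.commute)
qed

lemma hclass_eq_iff: "hclass K c = hclass K d \<longleftrightarrow> c - d \<in> edge_generated K"
proof
  assume eq: "hclass K c = hclass K d"
  have "c \<in> hclass K c"
    unfolding hclass_iff using col.subspace_0[OF subspace_edge_generated] by (metis diff_self)
  then show "c - d \<in> edge_generated K" unfolding eq hclass_iff .
next
  assume cd: "c - d \<in> edge_generated K"
  have "x - c \<in> edge_generated K \<longleftrightarrow> x - d \<in> edge_generated K" for x
  proof
    assume "x - c \<in> edge_generated K"
    then have "(x - c) + (c - d) \<in> edge_generated K" by (rule col.subspace_add[OF subspace_edge_generated _ cd])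
    then show "x - d \<in> edge_generated K" by (metis diff_add_cancel add_diff_eq)
  next
    assume "x - d \<in> edge_generated K"
    then have "(x - d) - (c - d) \<in> edge_generated K" by (rule col.subspace_diff[OF subspace_edge_generated _ cd])
    then show "x - c \<in> edge_generated K" by (metis diff_diff_eq2 diff_add_cancel)
  qed
  then show "hclass K c = hclass K d" using hclass_iff by (intro set_eqI) blast
qed

lemma restr_linear:
  "restr L (c - d) = restr L c - restr L d"
  "restr L (c + d) = restr L c + restr L d"
  "restr L (cscale a c) = cscale a (restr L c)"
  by (rule ext, simp add: restr_def cscale_def zero_prod_def)+

text \<open>
  The linear algebra behind a canonical isomorphism of quotients: a linear relation that is total on both sides and
  relates edge-generated colorings only to edge-generated ones becomes the graph of a linear bijection.
\<close>

lemma correspondence_induces_Hcol_iso: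
  fixes K K' R :: "'v::linorder complex"
  defines "T \<equiv> {(hclass K c, hclass K' c') |(c :: ('v, 'f::field) coloring) c'.
            c \<in> permitted K \<and> c' \<in> permitted K' \<and> restr R c = restr R c'}"
  assumes total: "\<And>c :: ('v, 'f) coloring. c \<in> permitted K \<Longrightarrow> \<exists>c'\<in>permitted K'. restr R c = restr R c'"
    and total': "\<And>c' :: ('v, 'f) coloring. c' \<in> permitted K' \<Longrightarrow> \<exists>c\<in>permitted K. restr R c = restr R c'"
    and eg: "\<And>c c' :: ('v, 'f) coloring. c \<in> permitted K \<Longrightarrow> c' \<in> permitted K' \<Longrightarrow>
      restr R c = restr R c' \<Longrightarrow> c \<in> edge_generated K \<longleftrightarrow> c' \<in> edge_generated K'"
  shows "\<exists>\<Phi>. Hcol_iso K K' \<Phi> \<and> T = {(X, \<Phi> X) |X. X \<in> Hcol K}"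
proof -
  have match: "hclass K c = hclass K d \<longleftrightarrow> hclass K' c' = hclass K' d'"
    if "c \<in> permitted K" "c' \<in> permitted K'" "restr R c = restr R c'"
      "d \<in> permitted K" "d' \<in> permitted K'" "restr R d = restr R d'" for c c' d d' :: "('v, 'f) coloring"
    unfolding hclass_eq_iff
    by (rule eg) (use that in \<open>simp_all add: restr_linear col.subspace_diff subspace_permitted\<close>)
  define \<Phi> where "\<Phi> X = (SOME Y. (X, Y) \<in> T)" for X
  have \<Phi>: "\<Phi> (hclass K c) = hclass K' c'"
    if c: "c \<in> permitted K" "c' \<in> permitted K'" "restr R c = restr R c'" for c c' :: "('v, 'f) coloring"
  proof -
    have "(hclass K c, hclass K' c') \<in> T" unfolding T_def using c by blast
    then have "(hclass K c, \<Phi> (hclass K c)) \<in> T" unfolding \<Phi>_def by (rule someI)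
    then obtain d d' where d: "hclass K c = hclass K d" "\<Phi> (hclass K c) = hclass K' d'"
      "d \<in> permitted K" "d' \<in> permitted K'" "restr R d = restr R d'" unfolding T_def by blast
    then show ?thesis using match[OF d(3-5) c] by simp
  qed
  have rep: "\<exists>c c'. X = hclass K c \<and> \<Phi> X = hclass K' c' \<and> c \<in> permitted K \<and> c' \<in> permitted K' \<and> restr R c = restr R c'"
    if "X \<in> Hcol K" for X :: "('v, 'f) coloring set"
  proof -
    obtain c where c: "X = hclass K c" "c \<in> permitted K" using \<open>X \<in> Hcol K\<close> by (auto simp: Hcol_def)
    obtain c' where "c' \<in> permitted K'" "restr R c = restr R c'" using total[OF c(2)] by blast
    then show ?thesis using c \<Phi> by blast
  qed
  have "bij_betw \<Phi> (Hcol K) (Hcol K')"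
  proof (rule bij_betw_imageI)
    show "inj_on \<Phi> (Hcol K)"
    proof (rule inj_onI)
      fix X Y assume X: "X \<in> Hcol K" and Y: "Y \<in> Hcol K" and e: "\<Phi> X = \<Phi> Y"
      obtain c c' where c: "X = hclass K c" "\<Phi> X = hclass K' c'" "c \<in> permitted K" "c' \<in> permitted K'" "restr R c = restr R c'"
        using rep[OF X] by blast
      obtain d d' where d: "Y = hclass K d" "\<Phi> Y = hclass K' d'" "d \<in> permitted K" "d' \<in> permitted K'" "restr R d = restr R d'"
        using rep[OF Y] by blast
      show "X = Y" using match[OF c(3-5) d(3-5)] c d e by simp
    qed
    show "\<Phi> ` Hcol K = Hcol K'"
    proof
      show "\<Phi> ` Hcol K \<subseteq> Hcol K'" using rep unfolding Hcol_def by fastforce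
      show "Hcol K' \<subseteq> \<Phi> ` Hcol K"
      proof
        fix Y :: "('v, 'f) coloring set" assume "Y \<in> Hcol K'"
        then obtain c' where c': "Y = hclass K' c'" "c' \<in> permitted K'" unfolding Hcol_def by blast
        obtain c where "c \<in> permitted K" "restr R c = restr R c'" using total'[OF c'(2)] by blast
        then have "Y = \<Phi> (hclass K c)" "hclass K c \<in> Hcol K" using \<Phi> c' unfolding Hcol_def by auto
        then show "Y \<in> \<Phi> ` Hcol K" by blast
      qed
    qed
  qed
  moreover have "\<Phi> (hadd X Y) = hadd (\<Phi> X) (\<Phi> Y)" if X: "X \<in> Hcol K" and Y: "Y \<in> Hcol K" for X Y
  proof -
    obtain c c' where c: "X = hclass K c" "\<Phi> X = hclass K' c'" "c \<in> permitted K" "c' \<in> permitted K'" "restr R c = restr R c'"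
      using rep[OF X] by blast
    obtain d d' where d: "Y = hclass K d" "\<Phi> Y = hclass K' d'" "d \<in> permitted K" "d' \<in> permitted K'" "restr R d = restr R d'"
      using rep[OF Y] by blast
    have "\<Phi> (hclass K (c + d)) = hclass K' (c' + d')"
      by (rule \<Phi>) (use c d in \<open>simp_all add: restr_linear col.subspace_add subspace_permitted\<close>)
    then show ?thesis unfolding c(2) d(2) unfolding c(1) d(1) hadd_hclass .
  qed
  moreover have "\<Phi> (hscale K a X) = hscale K' a (\<Phi> X)" if X: "X \<in> Hcol K" for a X
  proof -
    obtain c c' where c: "X = hclass K c" "\<Phi> X = hclass K' c'" "c \<in> permitted K" "c' \<in> permitted K'" "restr R c = restr R c'"
      using rep[OF X] by blast
    have "\<Phi> (hclass K (cscale a c)) = hclass K' (cscale a c')"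
      by (rule \<Phi>) (use c in \<open>simp_all add: restr_linear col.subspace_scale subspace_permitted\<close>)
    then show ?thesis unfolding c(2) unfolding c(1) hscale_hclass .
  qed
  moreover have "T = {(X, \<Phi> X) |X. X \<in> Hcol K}"
  proof
    show "T \<subseteq> {(X, \<Phi> X) |X. X \<in> Hcol K}"
      unfolding T_def Hcol_def using \<Phi> by fastforce
    show "{(X, \<Phi> X) |X. X \<in> Hcol K} \<subseteq> T"
    proof
      fix p assume "p \<in> {(X, \<Phi> X) |X. X \<in> Hcol K}"
      then obtain X where X: "p = (X, \<Phi> X)" "X \<in> Hcol K" by blast
      show "p \<in> T" using rep[OF X(2)] unfolding X(1) T_def by blast
    qed
  qed
  ultimately show ?thesis unfolding Hcol_iso_def by blast
qed


section \<open>Pachner invariance of coloring homology\<close>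

theorem theorem1:
  fixes D :: "'v::linorder set"
    and P :: "'v set set"
    and k :: nat
    and C C' :: "'v complex"
  assumes "card D = 6"
    and "1 \<le> k" and "k \<le> 5"
    and "P \<subseteq> {u. u \<subseteq> D \<and> card u = 5}" and "card P = k"
    and "C = faces P"
    and "C' = faces ({u. u \<subseteq> D \<and> card u = 5} - P)"
  shows "boundary C = boundary C' \<and>
    (restr (boundary C) ` permitted C :: ('v, 'f::field) coloring set)
      = restr (boundary C') ` permitted C' \<and>
    (restr (boundary C) ` permitted C :: ('v, 'f::field) coloring set)
      \<subseteq> col.span ((\<lambda>b. restr (boundary C) (edge_vector C b)) ` edges (boundary C)) \<and>
    col.dim (permitted_rel C :: ('v, 'f) coloring set) = pachner_dim k \<and>
    col.dim (permitted_rel C' :: ('v, 'f) coloring set) = pachner_dim (6 - k) \<and>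
    (permitted_rel C :: ('v, 'f::field) coloring set)
      = col.span (edge_vector C ` inner_edges C) \<and>
    (permitted_rel C' :: ('v, 'f::field) coloring set)
      = col.span (edge_vector C' ` inner_edges C') \<and>
    (\<forall>(M :: 'm::euclidean_space set) (p :: 'v \<Rightarrow> 'e\<^sub>1::euclidean_space) h (p' :: 'v \<Rightarrow> 'e\<^sub>2::euclidean_space) h' K K' R.
      closed_pl_4_manifold M \<and> triangulates p h K M \<and> triangulates p' h' K' M \<and>
      pachner_replacement C C' R K K' \<longrightarrow>
      (\<exists>\<Phi> :: ('v, 'f) coloring set \<Rightarrow> ('v, 'f) coloring set.
        Hcol_iso K K' \<Phi> \<and>
        {(hclass K c, hclass K' c') |c c'.
            c \<in> permitted K \<and> c' \<in> permitted K' \<and> restr R c = restr R c'}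
          = {(X, \<Phi> X) |X. X \<in> Hcol K}))"
proof -
  note D = assms(1)
  have fin: "finite D" using D card.infinite by fastforce
  \<comment> \<open>The pentachora of \<open>P\<close> are encoded by the vertices opposite to them.\<close>
  define I where "I = {i \<in> D. D - {i} \<in> P}"
  have ID: "I \<subseteq> D" by (auto simp: I_def)
  have inj: "inj_on (\<lambda>i. D - {i}) D" by (auto simp: inj_on_def)
  have all: "{u. u \<subseteq> D \<and> card u = 5} = (\<lambda>i. D - {i}) ` D"
  proof
    show "{u. u \<subseteq> D \<and> card u = 5} \<subseteq> (\<lambda>i. D - {i}) ` D"
      by (clarify elim!: five_subset_of_six[OF D]) blast
  qed (use D in auto)
  have P: "P = (\<lambda>i. D - {i}) ` I" using assms(4) unfolding all I_def by auto
  have P': "{u. u \<subseteq> D \<and> card u = 5} - P = (\<lambda>i. D - {i}) ` (D - I)"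
    unfolding all P by (rule inj_on_image_set_diff[OF inj, symmetric]) (use ID in auto)
  have cI: "card I = k"
    using assms(5) card_image[OF inj_on_subset[OF inj ID]] unfolding P by simp
  have cI': "card (D - I) = 6 - k" using D ID fin cI by (simp add: card_Diff_subset finite_subset)
  have I: "I \<noteq> {}" "I \<noteq> D" using cI assms(2,3) D by auto
  have I': "D - I \<subseteq> D" "D - I \<noteq> {}" "D - I \<noteq> D" "D - (D - I) = I" using I ID by auto
  have C: "C = pachner_side D I" using assms(6) faces_opposite_pentachora[OF ID] P by simp
  have C': "C' = pachner_side D (D - I)"
    using assms(7) faces_opposite_pentachora[OF I'(1)] P' by simp
  have cx: "abstract_complex C" "abstract_complex C'" unfolding C C' by (rule abstract_pachner_side[OF fin])+
  have B: "boundary C = boundary C'"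
    unfolding C C' boundary_pachner_side[OF D ID] boundary_pachner_side[OF D I'(1)] I'(4) by auto
  have traceC: "(restr (boundary C) ` permitted C :: ('v, 'f) coloring set) = range (\<lambda>c. restr (boundary C) (cochain_color c))"
    using restr_boundary_permitted_side[OF D ID I, of "boundary C"] boundary_subset[OF cx(1)] unfolding C by simp
  have traceC': "(restr (boundary C') ` permitted C' :: ('v, 'f) coloring set) = range (\<lambda>c. restr (boundary C') (cochain_color c))"
    using restr_boundary_permitted_side[OF D I'(1-3), of "boundary C'"] boundary_subset[OF cx(2)] unfolding C' by simp
  have trace: "(restr (boundary C) ` permitted C :: ('v, 'f) coloring set) = restr (boundary C') ` permitted C'"
    unfolding traceC traceC' unfolding B ..
  have gen: "(\<lambda>b. restr (boundary C) (edge_vector C b :: ('v, 'f) coloring)) = edge_vector (boundary C)"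
  proof (intro ext)
    fix b t show "restr (boundary C) (edge_vector C b) t = (edge_vector (boundary C) b t :: 'f \<times> 'f)"
      using boundary_subset[OF cx(1)] by (auto simp: restr_def edge_vector_def tetrahedra_def)
  qed
  have span: "(restr (boundary C) ` permitted C :: ('v, 'f) coloring set)
      \<subseteq> col.span ((\<lambda>b. restr (boundary C) (edge_vector C b)) ` edges (boundary C))"
    unfolding traceC gen using edge_generated_eq[OF abstract_boundary[OF cx(1)]]
    unfolding edge_generated_def by blast
  have rel: "(permitted_rel C :: ('v, 'f) coloring set) = col.span (edge_vector C ` inner_edges C)"
    unfolding C by (rule permitted_rel_side[OF D ID I])
  have rel': "(permitted_rel C' :: ('v, 'f) coloring set) = col.span (edge_vector C' ` inner_edges C')"
    unfolding C' by (rule permitted_rel_side[OF D I'(1-3)])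
  have dim: "col.dim (permitted_rel C :: ('v, 'f) coloring set) = pachner_dim k"
    unfolding C cI[symmetric] by (rule dim_permitted_rel_side[OF D ID I])
  have dim': "col.dim (permitted_rel C' :: ('v, 'f) coloring set) = pachner_dim (6 - k)"
    unfolding C' cI'[symmetric] by (rule dim_permitted_rel_side[OF D I'(1-3)])
  have iso: "\<exists>\<Phi> :: ('v, 'f) coloring set \<Rightarrow> ('v, 'f) coloring set.
        Hcol_iso K K' \<Phi> \<and>
        {(hclass K c, hclass K' c') |c c'.
            c \<in> permitted K \<and> c' \<in> permitted K' \<and> restr R c = restr R c'}
          = {(X, \<Phi> X) |X. X \<in> Hcol K}"
    if K: "abstract_complex K" and move: "pachner_replacement C C' R K K'" for K K' R
  proof -
    have m: "K = R \<union> C" "K' = R \<union> C'" "R = faces (K - C)" "R \<inter> C = boundary C" "R \<inter> C' = boundary C'"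
      using move unfolding pachner_replacement_def closed_complement_def by blast+
    have "finite R" using abstract_complexD(1)[OF K] m(1) by simp
    moreover have "s \<noteq> {}" if "s \<in> R" for s
      using that m(3) by (simp add: faces_def)
    moreover have "finite s" if "s \<in> R" for s
      using that abstract_complexD(2)[OF K, of s] unfolding m(1) by simp
    moreover have "r \<in> R" if s: "s \<in> R" "r \<subseteq> s" "r \<noteq> {}" for r s
    proof -
      obtain s' where "s' \<in> K - C" "s \<subseteq> s'" using s(1) m(3) by (auto simp: faces_def)
      then have "\<exists>s\<in>K - C. r \<subseteq> s" using s(2) by blast
      then have "r \<in> faces (K - C)" using s(3) by (simp add: faces_def)
      then show ?thesis using m(3) by simp
    qed
    ultimately have R: "abstract_complex R" unfolding abstract_complex_def by blast
    show ?thesis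
    proof (rule correspondence_induces_Hcol_iso)
      fix c :: "('v, 'f) coloring" assume "c \<in> permitted K"
      then have "c \<in> permitted (R \<union> C)" by (simp only: m(1))
      moreover have "restr (boundary C) ` permitted C \<subseteq> (restr (boundary C) ` permitted C' :: ('v, 'f) coloring set)"
        using trace B by simp
      ultimately obtain c' where "c' \<in> permitted (R \<union> C')" "restr R c = restr R c'"
        using permitted_extends_across_replacement[OF R cx m(4) m(5)[folded B]] by metis
      then show "\<exists>c'\<in>permitted K'. restr R c = restr R c'" unfolding m(2) by blast
    next
      fix c' :: "('v, 'f) coloring" assume "c' \<in> permitted K'"
      then have "c' \<in> permitted (R \<union> C')" by (simp only: m(2))
      moreover have "restr (boundary C) ` permitted C' \<subseteq> (restr (boundary C) ` permitted C :: ('v, 'f) coloring set)"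
        using trace B by simp
      ultimately obtain c where "c \<in> permitted (R \<union> C)" "restr R c' = restr R c"
        using permitted_extends_across_replacement[OF R cx(2,1) m(5)[folded B] m(4)] by metis
      then show "\<exists>c\<in>permitted K. restr R c = restr R c'" unfolding m(1) by metis
    next
      fix c c' :: "('v, 'f) coloring"
      assume c: "c \<in> permitted K" "c' \<in> permitted K'" "restr R c = restr R c'"
      show "c \<in> edge_generated K \<longleftrightarrow> c' \<in> edge_generated K'"
        using edge_generated_transfers_across_replacement[OF R cx m(5) rel', of c c']
          edge_generated_transfers_across_replacement[OF R cx(2,1) m(4) rel, of c' c] c
        unfolding m(1,2) by auto
    qed
  qed
  have iso': "\<forall>(M :: 'm set) (p :: 'v \<Rightarrow> 'e\<^sub>1) h (p' :: 'v \<Rightarrow> 'e\<^sub>2) h' K K' R.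
      closed_pl_4_manifold M \<and> triangulates p h K M \<and> triangulates p' h' K' M \<and>
      pachner_replacement C C' R K K' \<longrightarrow>
      (\<exists>\<Phi> :: ('v, 'f) coloring set \<Rightarrow> ('v, 'f) coloring set.
        Hcol_iso K K' \<Phi> \<and>
        {(hclass K c, hclass K' c') |c c'.
            c \<in> permitted K \<and> c' \<in> permitted K' \<and> restr R c = restr R c'}
          = {(X, \<Phi> X) |X. X \<in> Hcol K})"
    by (intro allI impI iso) (simp_all add: triangulates_def)
  show ?thesis by (intro conjI B trace span dim dim' rel rel' iso')
qed

end
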